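(* Let $H$ be a subgroup of a finite group $G$, let $A\in\mathcal{P}_H(G/H)$, let $K:=\{g\in G\mid gA=A\}$, and let $W$ be an irreducible representation of $K$. Then the globalization of the irreducible $H$-global $G$-partial representation $\mathsf{Ind}_AW$ is given by the induced representation $\mathsf{Ind}_K^GW=\mathbb{C}[G]\otimes_{\mathbb{C}[K]}W$ with the obvious inclusion $\varphi\colon\mathsf{Ind}_AW\to\mathsf{Ind}_K^GW$ and projection $\tau\colon\mathsf{Ind}_K^GW\to\mathsf{Ind}_AW$.
   Context: All groups are finite and all vector spaces are finite-dimensional over $\mathbb{C}$. A $G$-partial representation $(V,\pi)$ is a map $\pi\colon G\to\operatorname{End}(V)$ such that for all $g,h\in G$: $\pi(1_G)=\mathrm{Id}_V$; $\pi(g^{-1})\pi(gh)=\pi(g^{-1})\pi(g)\pi(h)$; $\pi(gh)\pi(h^{-1})=\pi(g)\pi(h)\pi(h^{-1})$. It is $H$-global if the restriction of $\pi$ to $H$ is a (usual) representation of $H$. $\mathcal{P}_H(G/H):=\{A\subseteq G\mid H\subseteq A\text{ and }A\text{ is a union of left cosets of }H\}$. For $A\in\mathcal{P}_H(G/H)$ with $K=\{g\in G\mid gA=A\}$, the set $A^{-1}$ is a union of left cosets of $K$ and is stable under left multiplication by $H$. For $xK\in G/K$, let $W^{xK}\subseteq\mathbb{C}[G]\otimes_{\mathbb{C}[K]}W$ be the subspace $\{x\otimes w\mid w\in W\}$. Then $$\mathsf{Ind}_AW=\bigoplus_{xK\in A^{-1}/K}W^{xK}\subseteq\bigoplus_{xK\in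 G/K}W^{xK}=\mathsf{Ind}_K^GW,$$ with $G$-partial representation $\pi(g)(x\otimes w)=gx\otimes w$ if $gx\in A^{-1}$ and $0$ otherwise ($x\in A^{-1}$). The map $\varphi$ is the inclusion, and $\tau$ is the projection with kernel $\bigoplus_{xK\not\subseteq A^{-1}}W^{xK}$. Restriction: let $(U,\rho)$ be a global (i.e. usual) representation of $G$ and let $\varphi\colon V\to U$, $\tau\colon U\to V$ be linear with $\tau\circ\varphi=\mathrm{Id}_V$. Define $\pi(g)(v):=\tau(\rho(g)(\varphi(v)))$. Then $(V,\pi)$ is the restriction of $(U,\rho)$ via $\varphi,\tau$ if $(V,\pi)$ is a $G$-partial representation and for every $g\in G$ and $v\in\pi(g^{-1})\pi(g)(V)$ one has $\varphi(\pi(g)(v))=\rho(g)(\varphi(v))$. A globalization of a $G$-partial representation $(V,\pi)$ is a quadruple $(U,\rho,\varphi,\tau)$ such that: (GR1) $(U,\rho)$ is a global representation of $G$; (GR2) $(V,\pi)$ is the restriction of $(U,\rho)$ via $\varphi$ and $\tau$; (GR3) for every quadruple $(U',\rho',\varphi',\tau')$ satisfying (GR1) and (GR2) there is a unique $G$-homomorphism $\psi\colon U\to U'$ with $\psi\circ\varphi=\varphi'$ and $\tau'\circ\psi=\tau$. *)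

theory Defs
  imports "Jordan_Normal_Form.VS_Connect" "HOL-Algebra.AbelCoset" "HOL-Algebra.Left_Coset"
begin

section \<open>Partial representations and globalizations\<close>

text \<open>Vector spaces are carrier-based (the \<open>module\<close> records of HOL-Algebra) over the field
  \<open>class_ring :: complex ring\<close>. The ring multiplication and unit that these records inherit play no
  role. Maps between vector spaces matter only on the carrier of their domain.\<close>

definition fd_space :: "(complex, 'v) module \<Rightarrow> bool" where
  "fd_space V \<longleftrightarrow> vectorspace class_ring V \<and> vectorspace.fin_dim class_ring V"

abbreviation lin_map :: "(complex, 'v) module \<Rightarrow> (complex, 'w) module \<Rightarrow> ('v \<Rightarrow> 'w) \<Rightarrow> bool" where
  "lin_map V W T \<equiv> linear_map (class_ring :: complex ring) V W T"

definition group_rep ::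
  "('g, 'm) monoid_scheme \<Rightarrow> (complex, 'v) module \<Rightarrow> ('g \<Rightarrow> 'v \<Rightarrow> 'v) \<Rightarrow> bool" where
  "group_rep G V \<pi> \<longleftrightarrow>
     fd_space V \<and>
     (\<forall>g\<in>carrier G. lin_map V V (\<pi> g)) \<and>
     (\<forall>v\<in>carrier V. \<pi> \<one>\<^bsub>G\<^esub> v = v) \<and>
     (\<forall>g\<in>carrier G. \<forall>h\<in>carrier G. \<forall>v\<in>carrier V. \<pi> (g \<otimes>\<^bsub>G\<^esub> h) v = \<pi> g (\<pi> h v))"

definition partial_rep ::
  "('g, 'm) monoid_scheme \<Rightarrow> (complex, 'v) module \<Rightarrow> ('g \<Rightarrow> 'v \<Rightarrow> 'v) \<Rightarrow> bool" where
  "partial_rep G V \<pi> \<longleftrightarrow>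
     fd_space V \<and>
     (\<forall>g\<in>carrier G. lin_map V V (\<pi> g)) \<and>
     (\<forall>v\<in>carrier V. \<pi> \<one>\<^bsub>G\<^esub> v = v) \<and>
     (\<forall>g\<in>carrier G. \<forall>h\<in>carrier G. \<forall>v\<in>carrier V.
        \<pi> (inv\<^bsub>G\<^esub> g) (\<pi> (g \<otimes>\<^bsub>G\<^esub> h) v) = \<pi> (inv\<^bsub>G\<^esub> g) (\<pi> g (\<pi> h v)) \<and>
        \<pi> (g \<otimes>\<^bsub>G\<^esub> h) (\<pi> (inv\<^bsub>G\<^esub> h) v) = \<pi> g (\<pi> h (\<pi> (inv\<^bsub>G\<^esub> h) v)))"

definition global_on ::
  "('g, 'm) monoid_scheme \<Rightarrow> 'g set \<Rightarrow> (complex, 'v) module \<Rightarrow> ('g \<Rightarrow> 'v \<Rightarrow> 'v) \<Rightarrow> bool" where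
  "global_on G H V \<pi> \<longleftrightarrow> group_rep (G\<lparr>carrier := H\<rparr>) V \<pi>"

text \<open>Irreducibility, for global and partial representations alike: the space is nonzero and has no
  proper nonzero subspace that is invariant under all operators.\<close>

definition irreducible_rep ::
  "('g, 'm) monoid_scheme \<Rightarrow> (complex, 'v) module \<Rightarrow> ('g \<Rightarrow> 'v \<Rightarrow> 'v) \<Rightarrow> bool" where
  "irreducible_rep G V \<pi> \<longleftrightarrow>
     carrier V \<noteq> {\<zero>\<^bsub>V\<^esub>} \<and>
     (\<forall>N. subspace class_ring N V \<and> (\<forall>g\<in>carrier G. \<pi> g ` N \<subseteq> N) \<longrightarrow>
        N = {\<zero>\<^bsub>V\<^esub>} \<or> N = carrier V)"

definition rep_hom ::
  "('g, 'm) monoid_scheme \<Rightarrow> (complex, 'u) module \<Rightarrow> ('g \<Rightarrow> 'u \<Rightarrow> 'u) \<Rightarrow>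
   (complex, 'v) module \<Rightarrow> ('g \<Rightarrow> 'v \<Rightarrow> 'v) \<Rightarrow> ('u \<Rightarrow> 'v) \<Rightarrow> bool" where
  "rep_hom G U \<rho> U' \<rho>' \<psi> \<longleftrightarrow>
     lin_map U U' \<psi> \<and> (\<forall>g\<in>carrier G. \<forall>u\<in>carrier U. \<psi> (\<rho> g u) = \<rho>' g (\<psi> u))"

definition is_restriction ::
  "('g, 'm) monoid_scheme \<Rightarrow> (complex, 'v) module \<Rightarrow> ('g \<Rightarrow> 'v \<Rightarrow> 'v) \<Rightarrow>
   (complex, 'u) module \<Rightarrow> ('g \<Rightarrow> 'u \<Rightarrow> 'u) \<Rightarrow> ('v \<Rightarrow> 'u) \<Rightarrow> ('u \<Rightarrow> 'v) \<Rightarrow> bool" where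
  "is_restriction G V \<pi> U \<rho> \<phi> \<tau> \<longleftrightarrow>
     lin_map V U \<phi> \<and> lin_map U V \<tau> \<and>
     (\<forall>v\<in>carrier V. \<tau> (\<phi> v) = v) \<and>
     (\<forall>g\<in>carrier G. \<forall>v\<in>carrier V. \<pi> g v = \<tau> (\<rho> g (\<phi> v))) \<and>
     partial_rep G V \<pi> \<and>
     (\<forall>g\<in>carrier G. \<forall>v\<in>(\<lambda>v. \<pi> (inv\<^bsub>G\<^esub> g) (\<pi> g v)) ` carrier V. \<phi> (\<pi> g v) = \<rho> g (\<phi> v))"

text \<open>HOL cannot quantify over types inside a formula, so the type of the vectors of the competing
  spaces \<open>U'\<close> in (GR3) is a parameter; the full universal property is the statement for every \<open>'u\<close>.
  The condition \<open>\<psi> \<in> extensional (carrier U)\<close> only makes the values of \<open>\<psi>\<close> outside the carrier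
  irrelevant for uniqueness.\<close>

definition is_globalization ::
  "'u itself \<Rightarrow> ('g, 'm) monoid_scheme \<Rightarrow> (complex, 'v) module \<Rightarrow> ('g \<Rightarrow> 'v \<Rightarrow> 'v) \<Rightarrow>
   (complex, 'w) module \<Rightarrow> ('g \<Rightarrow> 'w \<Rightarrow> 'w) \<Rightarrow> ('v \<Rightarrow> 'w) \<Rightarrow> ('w \<Rightarrow> 'v) \<Rightarrow> bool" where
  "is_globalization (_ :: 'u itself) G V \<pi> U \<rho> \<phi> \<tau> \<longleftrightarrow>
     group_rep G U \<rho> \<and>
     is_restriction G V \<pi> U \<rho> \<phi> \<tau> \<and>
     (\<forall>(U' :: (complex, 'u) module) \<rho>' \<phi>' \<tau>'.
        group_rep G U' \<rho>' \<and> is_restriction G V \<pi> U' \<rho>' \<phi>' \<tau>' \<longrightarrow>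
        (\<exists>!\<psi>. \<psi> \<in> extensional (carrier U) \<and> rep_hom G U \<rho> U' \<rho>' \<psi> \<and>
             (\<forall>v\<in>carrier V. \<psi> (\<phi> v) = \<phi>' v) \<and>
             (\<forall>u\<in>carrier U. \<tau>' (\<psi> u) = \<tau> u)))"


section \<open>Tensor products over an algebra\<close>

definition delta :: "'a \<Rightarrow> 'a \<Rightarrow> complex" where
  "delta x = (\<lambda>y. of_bool (y = x))"

definition free_space :: "'a set \<Rightarrow> (complex, 'a \<Rightarrow> complex) module" where
  "free_space S =
     \<lparr>carrier = {f. finite {x. f x \<noteq> 0} \<and> {x. f x \<noteq> 0} \<subseteq> S},
      mult = (\<lambda>_ _. undefined), one = undefined,
      zero = (\<lambda>_. 0), add = (\<lambda>f g x. f x + g x), smult = (\<lambda>c f x. c * f x)\<rparr>"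

definition quotient_space :: "(complex, 'v) module \<Rightarrow> 'v set \<Rightarrow> (complex, 'v set) module" where
  "quotient_space V N =
     \<lparr>carrier = a_rcosets\<^bsub>V\<^esub> N,
      mult = (\<lambda>_ _. undefined), one = undefined,
      zero = N, add = set_add V, smult = (\<lambda>c X. \<Union>x\<in>X. N +>\<^bsub>V\<^esub> (c \<odot>\<^bsub>V\<^esub> x))\<rparr>"

text \<open>The tensor product of a right module \<open>M\<close> and a left module \<open>N\<close> over a complex algebra with
  carrier \<open>R\<close> (actions \<open>ra\<close> and \<open>la\<close>): the free vector space on \<open>M \<times> N\<close> modulo the relations of
  additivity in both arguments, \<open>R\<close>-balancedness, and compatibility with the scalars. As the
  scalars lie in \<open>R\<close>, homogeneity in the second argument follows from balancedness.\<close>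

definition tensor_relations ::
  "(complex, 'm) module \<Rightarrow> 'r set \<Rightarrow> ('m \<Rightarrow> 'r \<Rightarrow> 'm) \<Rightarrow> ('r \<Rightarrow> 'n \<Rightarrow> 'n) \<Rightarrow> (complex, 'n) module \<Rightarrow>
   ('m \<times> 'n \<Rightarrow> complex) set" where
  "tensor_relations M R ra la N =
     (let F = free_space (carrier M \<times> carrier N) in
      LinearCombinations.module.span class_ring F
       ({delta (a \<oplus>\<^bsub>M\<^esub> b, w) \<ominus>\<^bsub>F\<^esub> (delta (a, w) \<oplus>\<^bsub>F\<^esub> delta (b, w)) | a b w.
           a \<in> carrier M \<and> b \<in> carrier M \<and> w \<in> carrier N} \<union>
        {delta (a, v \<oplus>\<^bsub>N\<^esub> w) \<ominus>\<^bsub>F\<^esub> (delta (a, v) \<oplus>\<^bsub>F\<^esub> delta (a, w)) | a v w.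
           a \<in> carrier M \<and> v \<in> carrier N \<and> w \<in> carrier N} \<union>
        {delta (ra a r, w) \<ominus>\<^bsub>F\<^esub> delta (a, la r w) | a r w.
           a \<in> carrier M \<and> r \<in> R \<and> w \<in> carrier N} \<union>
        {delta (c \<odot>\<^bsub>M\<^esub> a, w) \<ominus>\<^bsub>F\<^esub> (c \<odot>\<^bsub>F\<^esub> delta (a, w)) | c a w.
           a \<in> carrier M \<and> w \<in> carrier N}))"

definition tensor_space ::
  "(complex, 'm) module \<Rightarrow> 'r set \<Rightarrow> ('m \<Rightarrow> 'r \<Rightarrow> 'm) \<Rightarrow> ('r \<Rightarrow> 'n \<Rightarrow> 'n) \<Rightarrow> (complex, 'n) module \<Rightarrow>
   (complex, ('m \<times> 'n \<Rightarrow> complex) set) module" where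
  "tensor_space M R ra la N =
     quotient_space (free_space (carrier M \<times> carrier N)) (tensor_relations M R ra la N)"

definition pure_tensor ::
  "(complex, 'm) module \<Rightarrow> 'r set \<Rightarrow> ('m \<Rightarrow> 'r \<Rightarrow> 'm) \<Rightarrow> ('r \<Rightarrow> 'n \<Rightarrow> 'n) \<Rightarrow> (complex, 'n) module \<Rightarrow>
   'm \<Rightarrow> 'n \<Rightarrow> ('m \<times> 'n \<Rightarrow> complex) set" where
  "pure_tensor M R ra la N a w =
     tensor_relations M R ra la N +>\<^bsub>free_space (carrier M \<times> carrier N)\<^esub> delta (a, w)"

text \<open>The linear map with \<open>gen i \<mapsto> img i\<close> for \<open>i \<in> I\<close>; only meaningful if it exists and the
  vectors \<open>gen i\<close> span \<open>V\<close>.\<close>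

definition linear_extension ::
  "(complex, 'v) module \<Rightarrow> (complex, 'w) module \<Rightarrow> 'i set \<Rightarrow> ('i \<Rightarrow> 'v) \<Rightarrow> ('i \<Rightarrow> 'w) \<Rightarrow> 'v \<Rightarrow> 'w" where
  "linear_extension V W I gen img =
     (THE T. T \<in> extensional (carrier V) \<and> lin_map V W T \<and> (\<forall>i\<in>I. T (gen i) = img i))"


section \<open>Induced representations\<close>

text \<open>The group algebra \<open>\<complex>[G]\<close> of a finite group. For a subgroup \<open>K\<close>, the subalgebra \<open>\<complex>[K]\<close> is
  \<open>group_algebra (G\<lparr>carrier := K\<rparr>)\<close>; its elements are the elements of \<open>\<complex>[G]\<close> supported in \<open>K\<close>.
  The group element \<open>x\<close> is \<open>delta x\<close>.\<close>

definition group_algebra :: "('g, 'm) monoid_scheme \<Rightarrow> (complex, 'g \<Rightarrow> complex) module" where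
  "group_algebra G =
     \<lparr>carrier = {a. \<forall>x. x \<notin> carrier G \<longrightarrow> a x = 0},
      mult = (\<lambda>a b z. if z \<in> carrier G
                then \<Sum>x\<in>carrier G. a x * b (inv\<^bsub>G\<^esub> x \<otimes>\<^bsub>G\<^esub> z) else 0),
      one = delta \<one>\<^bsub>G\<^esub>,
      zero = (\<lambda>_. 0), add = (\<lambda>a b x. a x + b x), smult = (\<lambda>c a x. c * a x)\<rparr>"

definition group_algebra_action ::
  "'g set \<Rightarrow> (complex, 'w) module \<Rightarrow> ('g \<Rightarrow> 'w \<Rightarrow> 'w) \<Rightarrow> ('g \<Rightarrow> complex) \<Rightarrow> 'w \<Rightarrow> 'w" where
  "group_algebra_action K W \<sigma> r w = (\<Oplus>\<^bsub>W\<^esub>k\<in>K. r k \<odot>\<^bsub>W\<^esub> \<sigma> k w)"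

type_synonym ('g, 'w) ind_vec = "(('g \<Rightarrow> complex) \<times> 'w \<Rightarrow> complex) set"

definition ind_space ::
  "('g, 'm) monoid_scheme \<Rightarrow> 'g set \<Rightarrow> (complex, 'w) module \<Rightarrow> ('g \<Rightarrow> 'w \<Rightarrow> 'w) \<Rightarrow>
   (complex, ('g, 'w) ind_vec) module" where
  "ind_space G K W \<sigma> =
     tensor_space (group_algebra G) (carrier (group_algebra (G\<lparr>carrier := K\<rparr>)))
       (mult (group_algebra G)) (group_algebra_action K W \<sigma>) W"

definition ind_tensor ::
  "('g, 'm) monoid_scheme \<Rightarrow> 'g set \<Rightarrow> (complex, 'w) module \<Rightarrow> ('g \<Rightarrow> 'w \<Rightarrow> 'w) \<Rightarrow>
   ('g \<Rightarrow> complex) \<Rightarrow> 'w \<Rightarrow> ('g, 'w) ind_vec" where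
  "ind_tensor G K W \<sigma> =
     pure_tensor (group_algebra G) (carrier (group_algebra (G\<lparr>carrier := K\<rparr>)))
       (mult (group_algebra G)) (group_algebra_action K W \<sigma>) W"

definition ind_action ::
  "('g, 'm) monoid_scheme \<Rightarrow> 'g set \<Rightarrow> (complex, 'w) module \<Rightarrow> ('g \<Rightarrow> 'w \<Rightarrow> 'w) \<Rightarrow>
   'g \<Rightarrow> ('g, 'w) ind_vec \<Rightarrow> ('g, 'w) ind_vec" where
  "ind_action G K W \<sigma> g =
     linear_extension (ind_space G K W \<sigma>) (ind_space G K W \<sigma>)
       (carrier (group_algebra G) \<times> carrier W)
       (\<lambda>(a, w). ind_tensor G K W \<sigma> a w)
       (\<lambda>(a, w). ind_tensor G K W \<sigma> (delta g \<otimes>\<^bsub>group_algebra G\<^esub> a) w)"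

text \<open>The subspace \<open>W\<^sup>C\<close> for a left coset \<open>C = xK\<close>. Letting \<open>x\<close> range over all of \<open>C\<close> avoids choosing a
  representative and changes nothing, since \<open>xk \<otimes> w = x \<otimes> kw\<close>.\<close>

definition coset_part ::
  "('g, 'm) monoid_scheme \<Rightarrow> 'g set \<Rightarrow> (complex, 'w) module \<Rightarrow> ('g \<Rightarrow> 'w \<Rightarrow> 'w) \<Rightarrow>
   'g set \<Rightarrow> ('g, 'w) ind_vec set" where
  "coset_part G K W \<sigma> C = {ind_tensor G K W \<sigma> (delta x) w | x w. x \<in> C \<and> w \<in> carrier W}"

definition coset_parts_sum ::
  "('g, 'm) monoid_scheme \<Rightarrow> 'g set \<Rightarrow> (complex, 'w) module \<Rightarrow> ('g \<Rightarrow> 'w \<Rightarrow> 'w) \<Rightarrow>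
   'g set set \<Rightarrow> ('g, 'w) ind_vec set" where
  "coset_parts_sum G K W \<sigma> CC =
     {\<Oplus>\<^bsub>ind_space G K W \<sigma>\<^esub>C\<in>CC. u C | u. \<forall>C\<in>CC. u C \<in> coset_part G K W \<sigma> C}"


section \<open>The partial representation induced from a union of cosets\<close>

definition coset_unions :: "('g, 'm) monoid_scheme \<Rightarrow> 'g set \<Rightarrow> 'g set set" where
  "coset_unions G H = {A. H \<subseteq> A \<and> (\<exists>CC \<subseteq> lcosets\<^bsub>G\<^esub> H. A = \<Union>CC)}"

definition left_stabilizer :: "('g, 'm) monoid_scheme \<Rightarrow> 'g set \<Rightarrow> 'g set" where
  "left_stabilizer G A = {g \<in> carrier G. g <#\<^bsub>G\<^esub> A = A}"

definition pind_space ::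
  "('g, 'm) monoid_scheme \<Rightarrow> 'g set \<Rightarrow> (complex, 'w) module \<Rightarrow> ('g \<Rightarrow> 'w \<Rightarrow> 'w) \<Rightarrow>
   (complex, ('g, 'w) ind_vec) module" where
  "pind_space G A W \<sigma> =
     (let K = left_stabilizer G A in
      ind_space G K W \<sigma>
        \<lparr>carrier := coset_parts_sum G K W \<sigma> {C \<in> lcosets\<^bsub>G\<^esub> K. C \<subseteq> set_inv\<^bsub>G\<^esub> A}\<rparr>)"

definition pind_action ::
  "('g, 'm) monoid_scheme \<Rightarrow> 'g set \<Rightarrow> (complex, 'w) module \<Rightarrow> ('g \<Rightarrow> 'w \<Rightarrow> 'w) \<Rightarrow>
   'g \<Rightarrow> ('g, 'w) ind_vec \<Rightarrow> ('g, 'w) ind_vec" where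
  "pind_action G A W \<sigma> g =
     (let K = left_stabilizer G A in
      linear_extension (pind_space G A W \<sigma>) (pind_space G A W \<sigma>)
        ((set_inv\<^bsub>G\<^esub> A) \<times> carrier W)
        (\<lambda>(x, w). ind_tensor G K W \<sigma> (delta x) w)
        (\<lambda>(x, w). if g \<otimes>\<^bsub>G\<^esub> x \<in> set_inv\<^bsub>G\<^esub> A
                  then ind_tensor G K W \<sigma> (delta (g \<otimes>\<^bsub>G\<^esub> x)) w
                  else \<zero>\<^bsub>ind_space G K W \<sigma>\<^esub>))"

definition pind_inclusion ::
  "('g, 'm) monoid_scheme \<Rightarrow> 'g set \<Rightarrow> (complex, 'w) module \<Rightarrow> ('g \<Rightarrow> 'w \<Rightarrow> 'w) \<Rightarrow>
   ('g, 'w) ind_vec \<Rightarrow> ('g, 'w) ind_vec" where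
  "pind_inclusion G A W \<sigma> = (\<lambda>v\<in>carrier (pind_space G A W \<sigma>). v)"

definition pind_projection ::
  "('g, 'm) monoid_scheme \<Rightarrow> 'g set \<Rightarrow> (complex, 'w) module \<Rightarrow> ('g \<Rightarrow> 'w \<Rightarrow> 'w) \<Rightarrow>
   ('g, 'w) ind_vec \<Rightarrow> ('g, 'w) ind_vec" where
  "pind_projection G A W \<sigma> =
     (let K = left_stabilizer G A in
      (\<lambda>u\<in>carrier (ind_space G K W \<sigma>).
        THE v. v \<in> carrier (pind_space G A W \<sigma>) \<and>
          (\<exists>z \<in> coset_parts_sum G K W \<sigma> {C \<in> lcosets\<^bsub>G\<^esub> K. \<not> C \<subseteq> set_inv\<^bsub>G\<^esub> A}.
             u = v \<oplus>\<^bsub>ind_space G K W \<sigma>\<^esub> z)))"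

end

theory Submission
  imports Defs
begin

text \<open>The induced representation \<open>V\<close> is spanned by the vectors \<open>x \<otimes> w\<close>, and a family of linear maps
  \<open>\<theta>\<^sub>x\<close> on \<open>W\<close> with \<open>\<theta>\<^sub>x\<^sub>k(w) = \<theta>\<^sub>x(kw)\<close> extends to a linear map on \<open>V\<close> with
  \<open>x \<otimes> w \<mapsto> \<theta>\<^sub>x(w)\<close>. Everything else follows from these two facts. For a set \<open>Z\<close> with
  \<open>ZK = Z\<close> they give the projection of \<open>V\<close> onto the cosets in \<open>Z\<close>; with \<open>B\<close> the inverse of \<open>A\<close>,
  the partial representation is the compression of the global one by the projection onto \<open>B\<close>.

  Globalization: since \<open>1 \<in> B\<close>, a homomorphism \<open>\<psi>\<close> that is compatible with \<open>\<phi>'\<close> must send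
  \<open>x \<otimes> w\<close> to \<open>\<rho>'(x)(\<phi>'(1 \<otimes> w))\<close>, and the restriction property of \<open>\<phi>'\<close> at the elements of
  \<open>B\<close>, in particular of \<open>K\<close>, shows that this formula is well defined and compatible with
  \<open>\<phi>'\<close> and \<open>\<tau>'\<close>.

  Irreducibility: the translates of \<open>B\<close> separate the cosets of \<open>K\<close>, so an invariant subspace contains
  the coset components of its vectors. If it is nonzero it therefore contains some nonzero
  \<open>x \<otimes> w\<close>, hence \<open>1 \<otimes> w\<close>, hence \<open>1 \<otimes> W\<close> as \<open>W\<close> is irreducible, hence everything.\<close>

section \<open>Linear maps and subspaces\<close>

lemma lin_mapI:
  assumes "vectorspace class_ring V" "vectorspace class_ring W"
    and "\<And>v. v \<in> carrier V \<Longrightarrow> T v \<in> carrier W"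
    and "\<And>u v. u \<in> carrier V \<Longrightarrow> v \<in> carrier V \<Longrightarrow> T (u \<oplus>\<^bsub>V\<^esub> v) = T u \<oplus>\<^bsub>W\<^esub> T v"
    and "\<And>c v. v \<in> carrier V \<Longrightarrow> T (c \<odot>\<^bsub>V\<^esub> v) = c \<odot>\<^bsub>W\<^esub> T v"
  shows "lin_map V W T"
  using assms
  by (simp add: linear_map_def mod_hom_def mod_hom_axioms_def
      LinearCombinations.module_hom_def vectorspace_def Pi_def)

lemma lin_mapD:
  assumes "lin_map V W T"
  shows "vectorspace class_ring V" "vectorspace class_ring W"
    and "v \<in> carrier V \<Longrightarrow> T v \<in> carrier W"
    and "u \<in> carrier V \<Longrightarrow> v \<in> carrier V \<Longrightarrow> T (u \<oplus>\<^bsub>V\<^esub> v) = T u \<oplus>\<^bsub>W\<^esub> T v"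
    and "v \<in> carrier V \<Longrightarrow> T (c \<odot>\<^bsub>V\<^esub> v) = c \<odot>\<^bsub>W\<^esub> T v"
    and "T \<zero>\<^bsub>V\<^esub> = \<zero>\<^bsub>W\<^esub>"
proof -
  interpret T: linear_map class_ring V W T by fact
  show "vectorspace class_ring V" "vectorspace class_ring W" by unfold_locales
  show "v \<in> carrier V \<Longrightarrow> T v \<in> carrier W" by simp
  show "u \<in> carrier V \<Longrightarrow> v \<in> carrier V \<Longrightarrow> T (u \<oplus>\<^bsub>V\<^esub> v) = T u \<oplus>\<^bsub>W\<^esub> T v" by simp
  show "v \<in> carrier V \<Longrightarrow> T (c \<odot>\<^bsub>V\<^esub> v) = c \<odot>\<^bsub>W\<^esub> T v" by simp
  show "T \<zero>\<^bsub>V\<^esub> = \<zero>\<^bsub>W\<^esub>" by simp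
qed

lemma lin_map_comp:
  assumes "lin_map U V S" "lin_map V W T"
  shows "lin_map U W (\<lambda>u. T (S u))"
  by (rule lin_mapI) (simp_all add: lin_mapD[OF assms(1)] lin_mapD[OF assms(2)])

lemma subspaceI:
  fixes V :: "(complex, 'v) module"
  assumes "vectorspace class_ring V" "N \<subseteq> carrier V" "\<zero>\<^bsub>V\<^esub> \<in> N"
    and "\<And>u v. u \<in> N \<Longrightarrow> v \<in> N \<Longrightarrow> u \<oplus>\<^bsub>V\<^esub> v \<in> N"
    and "\<And>c v. v \<in> N \<Longrightarrow> c \<odot>\<^bsub>V\<^esub> v \<in> N"
  shows "subspace class_ring N V"
  using assms by (simp add: subspace_def submodule_def vectorspace_def)

lemma subspaceD:
  fixes V :: "(complex, 'v) module"
  assumes "subspace class_ring N V"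
  shows "vectorspace class_ring V" "N \<subseteq> carrier V" "\<zero>\<^bsub>V\<^esub> \<in> N"
    and "u \<in> N \<Longrightarrow> v \<in> N \<Longrightarrow> u \<oplus>\<^bsub>V\<^esub> v \<in> N"
    and "v \<in> N \<Longrightarrow> c \<odot>\<^bsub>V\<^esub> v \<in> N"
  using assms by (simp_all add: subspace_def submodule_def)

text \<open>The additive inverse is demanded in the form \<open>(-1) \<odot> v\<close>, so that
  instances verify an equation and never have to produce a witness.\<close>

lemma vectorspace_criteria:
  fixes V :: "(complex, 'v) module"
  assumes "\<zero>\<^bsub>V\<^esub> \<in> carrier V"
    and "\<And>u v. u \<in> carrier V \<Longrightarrow> v \<in> carrier V \<Longrightarrow> u \<oplus>\<^bsub>V\<^esub> v \<in> carrier V"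
    and "\<And>c v. v \<in> carrier V \<Longrightarrow> c \<odot>\<^bsub>V\<^esub> v \<in> carrier V"
    and "\<And>u v. u \<in> carrier V \<Longrightarrow> v \<in> carrier V \<Longrightarrow> u \<oplus>\<^bsub>V\<^esub> v = v \<oplus>\<^bsub>V\<^esub> u"
    and "\<And>u v w. u \<in> carrier V \<Longrightarrow> v \<in> carrier V \<Longrightarrow> w \<in> carrier V \<Longrightarrow>
      (u \<oplus>\<^bsub>V\<^esub> v) \<oplus>\<^bsub>V\<^esub> w = u \<oplus>\<^bsub>V\<^esub> (v \<oplus>\<^bsub>V\<^esub> w)"
    and "\<And>v. v \<in> carrier V \<Longrightarrow> v \<oplus>\<^bsub>V\<^esub> \<zero>\<^bsub>V\<^esub> = v"
    and "\<And>v. v \<in> carrier V \<Longrightarrow> (-1) \<odot>\<^bsub>V\<^esub> v \<oplus>\<^bsub>V\<^esub> v = \<zero>\<^bsub>V\<^esub>"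
    and "\<And>c d v. v \<in> carrier V \<Longrightarrow> (c + d) \<odot>\<^bsub>V\<^esub> v = c \<odot>\<^bsub>V\<^esub> v \<oplus>\<^bsub>V\<^esub> d \<odot>\<^bsub>V\<^esub> v"
    and "\<And>c u v. u \<in> carrier V \<Longrightarrow> v \<in> carrier V \<Longrightarrow>
      c \<odot>\<^bsub>V\<^esub> (u \<oplus>\<^bsub>V\<^esub> v) = c \<odot>\<^bsub>V\<^esub> u \<oplus>\<^bsub>V\<^esub> c \<odot>\<^bsub>V\<^esub> v"
    and "\<And>c d v. v \<in> carrier V \<Longrightarrow> (c * d) \<odot>\<^bsub>V\<^esub> v = c \<odot>\<^bsub>V\<^esub> (d \<odot>\<^bsub>V\<^esub> v)"
    and "\<And>v. v \<in> carrier V \<Longrightarrow> 1 \<odot>\<^bsub>V\<^esub> v = v"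
  shows "vectorspace class_ring V"
proof (rule vs_criteria)
  show "field (class_ring :: complex ring)" by (rule class_field)
  show "\<forall>v\<in>carrier V. \<exists>w\<in>carrier V. v \<oplus>\<^bsub>V\<^esub> w = \<zero>\<^bsub>V\<^esub>"
    using assms(3,4,7) by metis
qed (use assms in auto)

lemma vectorspaceD:
  fixes V :: "(complex, 'v) module"
  assumes "vectorspace class_ring V"
  shows "\<zero>\<^bsub>V\<^esub> \<in> carrier V"
    and "u \<in> carrier V \<Longrightarrow> v \<in> carrier V \<Longrightarrow> u \<oplus>\<^bsub>V\<^esub> v \<in> carrier V"
    and "v \<in> carrier V \<Longrightarrow> c \<odot>\<^bsub>V\<^esub> v \<in> carrier V"
    and "v \<in> carrier V \<Longrightarrow> 0 \<odot>\<^bsub>V\<^esub> v = \<zero>\<^bsub>V\<^esub>"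
    and "v \<in> carrier V \<Longrightarrow> 1 \<odot>\<^bsub>V\<^esub> v = v"
    and "c \<odot>\<^bsub>V\<^esub> \<zero>\<^bsub>V\<^esub> = \<zero>\<^bsub>V\<^esub>"
    and "v \<in> carrier V \<Longrightarrow> v \<oplus>\<^bsub>V\<^esub> \<zero>\<^bsub>V\<^esub> = v"
    and "v \<in> carrier V \<Longrightarrow> \<zero>\<^bsub>V\<^esub> \<oplus>\<^bsub>V\<^esub> v = v"
    and "v \<in> carrier V \<Longrightarrow> c \<odot>\<^bsub>V\<^esub> (d \<odot>\<^bsub>V\<^esub> v) = (c * d) \<odot>\<^bsub>V\<^esub> v"
    and "v \<in> carrier V \<Longrightarrow> (c + d) \<odot>\<^bsub>V\<^esub> v = c \<odot>\<^bsub>V\<^esub> v \<oplus>\<^bsub>V\<^esub> d \<odot>\<^bsub>V\<^esub> v"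
    and "u \<in> carrier V \<Longrightarrow> v \<in> carrier V \<Longrightarrow> c \<odot>\<^bsub>V\<^esub> (u \<oplus>\<^bsub>V\<^esub> v) = c \<odot>\<^bsub>V\<^esub> u \<oplus>\<^bsub>V\<^esub> c \<odot>\<^bsub>V\<^esub> v"
proof -
  interpret vectorspace class_ring V by fact
  show "v \<in> carrier V \<Longrightarrow> c \<odot>\<^bsub>V\<^esub> v \<in> carrier V" by simp
  show "v \<in> carrier V \<Longrightarrow> 0 \<odot>\<^bsub>V\<^esub> v = \<zero>\<^bsub>V\<^esub>" using smult_l_null[of v] by simp
  show "v \<in> carrier V \<Longrightarrow> 1 \<odot>\<^bsub>V\<^esub> v = v" using smult_one[of v] by simp
  show "c \<odot>\<^bsub>V\<^esub> \<zero>\<^bsub>V\<^esub> = \<zero>\<^bsub>V\<^esub>" using smult_r_null[of c] by simp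
  show "v \<in> carrier V \<Longrightarrow> c \<odot>\<^bsub>V\<^esub> (d \<odot>\<^bsub>V\<^esub> v) = (c * d) \<odot>\<^bsub>V\<^esub> v"
    using smult_assoc1[of c d v] by simp
  show "v \<in> carrier V \<Longrightarrow> (c + d) \<odot>\<^bsub>V\<^esub> v = c \<odot>\<^bsub>V\<^esub> v \<oplus>\<^bsub>V\<^esub> d \<odot>\<^bsub>V\<^esub> v"
    using smult_l_distr[of c d v] by simp
  show "u \<in> carrier V \<Longrightarrow> v \<in> carrier V \<Longrightarrow> c \<odot>\<^bsub>V\<^esub> (u \<oplus>\<^bsub>V\<^esub> v) = c \<odot>\<^bsub>V\<^esub> u \<oplus>\<^bsub>V\<^esub> c \<odot>\<^bsub>V\<^esub> v"
    using smult_r_distr[of c u v] by simp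
  show "\<zero>\<^bsub>V\<^esub> \<in> carrier V" by simp
  show "u \<in> carrier V \<Longrightarrow> v \<in> carrier V \<Longrightarrow> u \<oplus>\<^bsub>V\<^esub> v \<in> carrier V" by simp
  show "v \<in> carrier V \<Longrightarrow> v \<oplus>\<^bsub>V\<^esub> \<zero>\<^bsub>V\<^esub> = v" by simp
  show "v \<in> carrier V \<Longrightarrow> \<zero>\<^bsub>V\<^esub> \<oplus>\<^bsub>V\<^esub> v = v" by simp
qed

lemma vectorspace_subspace:
  fixes V :: "(complex, 'v) module"
  shows "subspace class_ring N V \<Longrightarrow> vectorspace class_ring (V\<lparr>carrier := N\<rparr>)"
  using vectorspace.subspace_is_vs subspaceD(1) by blast

text \<open>Spanning is phrased by minimality: each subspace that contains \<open>B\<close> is the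
  whole space. Together with \<open>fd_spaceE\<close> and \<open>subspace_vimage\<close> this
  replaces explicit linear combinations.\<close>

lemma fd_spaceI:
  fixes V :: "(complex, 'v) module"
  assumes "vectorspace class_ring V" "finite B" "B \<subseteq> carrier V"
    and "\<And>N. subspace class_ring N V \<Longrightarrow> B \<subseteq> N \<Longrightarrow> carrier V \<subseteq> N"
  shows "fd_space V"
proof -
  interpret vectorspace class_ring V by fact
  have "subspace class_ring (span B) V" using assms(3) by (rule span_is_subspace)
  moreover have "B \<subseteq> span B" using assms(3) by (rule in_own_span)
  ultimately have "carrier V \<subseteq> span B" using assms(4) by blast
  moreover have "span B \<subseteq> carrier V" using assms(3) by (rule span_is_subset2)
  ultimately show ?thesis
    unfolding fd_space_def fin_dim_def using assms by blast
qed

lemma fd_spaceE: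
  fixes V :: "(complex, 'v) module"
  assumes "fd_space V"
  obtains B where "finite B" "B \<subseteq> carrier V"
    and "\<And>N. subspace class_ring N V \<Longrightarrow> B \<subseteq> N \<Longrightarrow> N = carrier V"
proof -
  interpret vectorspace class_ring V using assms by (simp add: fd_space_def)
  obtain B where B: "finite B" "B \<subseteq> carrier V" "span B = carrier V"
    using assms unfolding fd_space_def fin_dim_def by blast
  show thesis
  proof (rule that[OF B(1,2)])
    fix N assume N: "subspace class_ring N V" "B \<subseteq> N"
    then have "span B \<subseteq> N" by (intro span_is_subset) (auto simp: subspace_def)
    then show "N = carrier V" using B(3) subspaceD(2)[OF N(1)] by blast
  qed
qed

lemma subspace_vimage:
  assumes "lin_map V W T" "subspace class_ring N W"
  shows "subspace class_ring {v \<in> carrier V. T v \<in> N} V"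
  by (rule subspaceI)
    (auto simp: lin_mapD[OF assms(1)] subspaceD[OF assms(2)] vectorspaceD[OF lin_mapD(1)[OF assms(1)]])

lemma fd_space_image:
  assumes "lin_map V W T" "T ` carrier V = carrier W" "fd_space V"
  shows "fd_space W"
proof -
  obtain B where B: "finite B" "B \<subseteq> carrier V"
    and *: "\<And>N. subspace class_ring N V \<Longrightarrow> B \<subseteq> N \<Longrightarrow> N = carrier V"
    using fd_spaceE[OF assms(3)] by blast
  show ?thesis
  proof (rule fd_spaceI)
    show "vectorspace class_ring W" by (rule lin_mapD[OF assms(1)])
    show "finite (T ` B)" "T ` B \<subseteq> carrier W" using B assms(2) by auto
    fix N assume N: "subspace class_ring N W" "T ` B \<subseteq> N"
    have "{v \<in> carrier V. T v \<in> N} = carrier V"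
      using * subspace_vimage[OF assms(1) N(1)] N(2) B(2) by blast
    then show "carrier W \<subseteq> N" unfolding assms(2)[symmetric] by blast
  qed
qed

section \<open>Free spaces, quotients and tensor products\<close>

lemma free_space_simps:
  "f \<in> carrier (free_space S) \<longleftrightarrow> finite {x. f x \<noteq> 0} \<and> {x. f x \<noteq> 0} \<subseteq> S"
  "\<zero>\<^bsub>free_space S\<^esub> = (\<lambda>_. 0)"
  "f \<oplus>\<^bsub>free_space S\<^esub> g = (\<lambda>x. f x + g x)"
  "c \<odot>\<^bsub>free_space S\<^esub> f = (\<lambda>x. c * f x)"
  by (simp_all add: free_space_def)

lemma vectorspace_free_space: "vectorspace class_ring (free_space S)"
proof (rule vectorspace_criteria, unfold free_space_simps)
  fix f g :: "'a \<Rightarrow> complex"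
  assume "finite {x. f x \<noteq> 0} \<and> {x. f x \<noteq> 0} \<subseteq> S" "finite {x. g x \<noteq> 0} \<and> {x. g x \<noteq> 0} \<subseteq> S"
  moreover have "{x. f x + g x \<noteq> 0} \<subseteq> {x. f x \<noteq> 0} \<union> {x. g x \<noteq> 0}" by auto
  ultimately show "finite {x. f x + g x \<noteq> 0} \<and> {x. f x + g x \<noteq> 0} \<subseteq> S"
    by (meson finite_Un finite_subset le_sup_iff subset_trans)
qed (auto simp: algebra_simps)

lemma delta_in_free_space: "p \<in> S \<Longrightarrow> delta p \<in> carrier (free_space S)"
  by (auto simp: free_space_simps delta_def)

lemma free_space_minus:
  assumes "f \<in> carrier (free_space S)" "g \<in> carrier (free_space S)"
  shows "f \<ominus>\<^bsub>free_space S\<^esub> g = (\<lambda>x. f x - g x)"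
proof -
  interpret vectorspace class_ring "free_space S" by (rule vectorspace_free_space)
  have "(-1) \<odot>\<^bsub>free_space S\<^esub> g \<in> carrier (free_space S)"
    using assms by (intro vectorspaceD(3)[OF vectorspace_free_space])
  then have "\<ominus>\<^bsub>free_space S\<^esub> g = (-1) \<odot>\<^bsub>free_space S\<^esub> g"
    using assms by (intro minus_equality) (simp_all add: free_space_simps)
  then show ?thesis by (simp add: a_minus_def free_space_simps)
qed

text \<open>Induction on a finite set that contains the support: one point \<open>p\<close> is split
  off by writing \<open>f\<close> as \<open>f p\<close> times \<open>delta p\<close> plus
  \<open>f\<close> with its value at \<open>p\<close> reset to 0. The zero function is a case of its
  own because \<open>S\<close> may be empty.\<close>

lemma free_space_induct [consumes 1, case_names zero delta add]:
  assumes "f \<in> carrier (free_space S)"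
    and "P (\<lambda>_. 0)"
    and "\<And>c p. p \<in> S \<Longrightarrow> P (c \<odot>\<^bsub>free_space S\<^esub> delta p)"
    and "\<And>f g. f \<in> carrier (free_space S) \<Longrightarrow> g \<in> carrier (free_space S) \<Longrightarrow> P f \<Longrightarrow> P g \<Longrightarrow>
      P (f \<oplus>\<^bsub>free_space S\<^esub> g)"
  shows "P f"
proof -
  have "\<forall>f. {x. f x \<noteq> 0} \<subseteq> F \<longrightarrow> P f" if "finite F" "F \<subseteq> S" for F
    using that
  proof (induction F rule: finite_induct)
    case empty
    have "f = (\<lambda>_. 0)" if "{x. f x \<noteq> 0} \<subseteq> {}" for f :: "'a \<Rightarrow> complex" using that by auto
    then show ?case using assms(2) by blast
  next
    case (insert p F)
    show ?case
    proof safe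
      fix f :: "'a \<Rightarrow> complex" assume f: "{x. f x \<noteq> 0} \<subseteq> insert p F"
      define g where "g = f(p := 0)"
      have g: "{x. g x \<noteq> 0} \<subseteq> F" using f by (auto simp: g_def)
      have "f = (f p \<odot>\<^bsub>free_space S\<^esub> delta p) \<oplus>\<^bsub>free_space S\<^esub> g"
        by (auto simp: free_space_simps delta_def g_def)
      moreover have "P g" using insert g by auto
      moreover have "g \<in> carrier (free_space S)"
        using g insert.hyps(1) insert.prems by (auto simp: free_space_simps intro: finite_subset)
      moreover have "f p \<odot>\<^bsub>free_space S\<^esub> delta p \<in> carrier (free_space S)"
        using insert.prems by (intro vectorspaceD(3)[OF vectorspace_free_space] delta_in_free_space) auto
      ultimately show "P f" using assms(3,4) insert.prems by (metis insert_subset)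
    qed
  qed
  then show ?thesis using assms(1) unfolding free_space_simps by blast
qed

definition free_extension ::
  "(complex, 'u) module \<Rightarrow> ('a \<Rightarrow> 'u) \<Rightarrow> ('a \<Rightarrow> complex) \<Rightarrow> 'u" where
  "free_extension U \<beta> f = (\<Oplus>\<^bsub>U\<^esub>p\<in>{p. f p \<noteq> 0}. f p \<odot>\<^bsub>U\<^esub> \<beta> p)"

text \<open>The sum in \<open>free_extension\<close> runs over the support, which changes with
  \<open>f\<close>. Linearity needs a common index set, and enlarging the support only adds terms
  with coefficient 0.\<close>

lemma free_extension_eq:
  assumes U: "vectorspace class_ring U" and \<beta>: "\<beta> \<in> S \<rightarrow> carrier U"
    and "finite F" "{p. f p \<noteq> 0} \<subseteq> F" "F \<subseteq> S"
  shows "free_extension U \<beta> f = (\<Oplus>\<^bsub>U\<^esub>p\<in>F. f p \<odot>\<^bsub>U\<^esub> \<beta> p)"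
proof -
  interpret U: vectorspace class_ring U by fact
  note sm = vectorspaceD[OF U]
  have *: "\<beta> p \<in> carrier U" if "p \<in> F" for p using that assms by auto
  show ?thesis unfolding free_extension_def
    by (rule U.add.finprod_mono_neutral_cong_left) (use assms * in \<open>auto simp: sm\<close>)
qed

lemma lin_map_free_extension:
  assumes U: "vectorspace class_ring U" and \<beta>: "\<beta> \<in> S \<rightarrow> carrier U"
  shows "lin_map (free_space S) U (free_extension U \<beta>)"
proof (rule lin_mapI[OF vectorspace_free_space U])
  interpret U: vectorspace class_ring U by fact
  note sm = vectorspaceD[OF U]
  have \<beta>': "\<beta> p \<in> carrier U" if "p \<in> S" for p using that \<beta> by auto
  fix f assume f: "f \<in> carrier (free_space S)"
  then have f': "finite {p. f p \<noteq> 0}" "{p. f p \<noteq> 0} \<subseteq> S" by (auto simp: free_space_simps)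
  show "free_extension U \<beta> f \<in> carrier U"
    unfolding free_extension_def using f' \<beta>' by (intro U.finsum_closed) (auto intro!: sm)
  show "free_extension U \<beta> (c \<odot>\<^bsub>free_space S\<^esub> f) = c \<odot>\<^bsub>U\<^esub> free_extension U \<beta> f" for c
  proof -
    have "free_extension U \<beta> (c \<odot>\<^bsub>free_space S\<^esub> f) =
      (\<Oplus>\<^bsub>U\<^esub>p\<in>{p. f p \<noteq> 0}. (c * f p) \<odot>\<^bsub>U\<^esub> \<beta> p)"
      using f' by (subst free_extension_eq[OF U \<beta> f'(1) _ f'(2)]) (auto simp: free_space_simps)
    also have "\<dots> = (\<Oplus>\<^bsub>U\<^esub>p\<in>{p. f p \<noteq> 0}. c \<odot>\<^bsub>U\<^esub> (f p \<odot>\<^bsub>U\<^esub> \<beta> p))"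
      using f' \<beta>' by (intro U.finsum_cong') (auto simp: sm)
    also have "\<dots> = c \<odot>\<^bsub>U\<^esub> free_extension U \<beta> f"
      unfolding free_extension_def using f' \<beta>'
      by (intro U.finsum_smult_ldistr[symmetric]) (auto intro!: sm)
    finally show ?thesis .
  qed
  fix g assume g: "g \<in> carrier (free_space S)"
  then have g': "finite {p. g p \<noteq> 0}" "{p. g p \<noteq> 0} \<subseteq> S" by (auto simp: free_space_simps)
  define F where "F = {p. f p \<noteq> 0} \<union> {p. g p \<noteq> 0}"
  have F: "finite F" "F \<subseteq> S" using f' g' by (auto simp: F_def)
  have "free_extension U \<beta> (f \<oplus>\<^bsub>free_space S\<^esub> g) = (\<Oplus>\<^bsub>U\<^esub>p\<in>F. (f p + g p) \<odot>\<^bsub>U\<^esub> \<beta> p)"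
    by (subst free_extension_eq[OF U \<beta> F(1) _ F(2)]) (auto simp: free_space_simps F_def)
  also have "\<dots> = (\<Oplus>\<^bsub>U\<^esub>p\<in>F. f p \<odot>\<^bsub>U\<^esub> \<beta> p \<oplus>\<^bsub>U\<^esub> g p \<odot>\<^bsub>U\<^esub> \<beta> p)"
    using F \<beta>' by (intro U.finsum_cong') (auto intro!: sm)
  also have "\<dots> = (\<Oplus>\<^bsub>U\<^esub>p\<in>F. f p \<odot>\<^bsub>U\<^esub> \<beta> p) \<oplus>\<^bsub>U\<^esub> (\<Oplus>\<^bsub>U\<^esub>p\<in>F. g p \<odot>\<^bsub>U\<^esub> \<beta> p)"
    using F \<beta>' by (intro U.finsum_addf) (auto intro!: sm)
  also have "\<dots> = free_extension U \<beta> f \<oplus>\<^bsub>U\<^esub> free_extension U \<beta> g"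
    using F by (simp add: free_extension_eq[OF U \<beta> F(1) _ F(2)] F_def)
  finally show "free_extension U \<beta> (f \<oplus>\<^bsub>free_space S\<^esub> g) =
    free_extension U \<beta> f \<oplus>\<^bsub>U\<^esub> free_extension U \<beta> g" .
qed

lemma free_extension_delta:
  assumes U: "vectorspace class_ring U" and "\<beta> p \<in> carrier U"
  shows "free_extension U \<beta> (delta p) = \<beta> p"
proof -
  interpret U: vectorspace class_ring U by fact
  have "{q. delta p q \<noteq> 0} = {p}" by (auto simp: delta_def)
  then show ?thesis
    unfolding free_extension_def using assms(2)
    by (simp add: delta_def vectorspaceD[OF U])
qed

section \<open>Quotients by a subspace\<close>

context
  fixes V :: "(complex, 'v) module" and N :: "'v set"
  assumes N: "subspace class_ring N V"
begin

interpretation V: vectorspace class_ring V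
  by (rule subspaceD(1)[OF N])

interpretation N: abelian_subgroup N V
proof (rule abelian_subgroupI3)
  have "\<ominus>\<^bsub>V\<^esub> v \<in> N" if "v \<in> N" for v
  proof -
    have "v \<in> carrier V" using that subspaceD(2)[OF N] by auto
    then have "\<ominus>\<^bsub>V\<^esub> v = (-1) \<odot>\<^bsub>V\<^esub> v"
      using V.smult_minus_1[of v] by (simp add: class_ring_simps)
    then show ?thesis using subspaceD(5)[OF N that] by simp
  qed
  then have "subgroup N (add_monoid V)"
    using subspaceD[OF N] by (auto intro!: V.add.subgroupI)
  then show "additive_subgroup N V" by (rule additive_subgroupI)
qed unfold_locales

lemma quotient_simps:
  "X \<in> carrier (quotient_space V N) \<longleftrightarrow> (\<exists>v\<in>carrier V. X = N +>\<^bsub>V\<^esub> v)"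
  "\<zero>\<^bsub>quotient_space V N\<^esub> = N"
  "v \<in> carrier V \<Longrightarrow> w \<in> carrier V \<Longrightarrow>
    (N +>\<^bsub>V\<^esub> v) \<oplus>\<^bsub>quotient_space V N\<^esub> (N +>\<^bsub>V\<^esub> w) = N +>\<^bsub>V\<^esub> (v \<oplus>\<^bsub>V\<^esub> w)"
  by (auto simp: quotient_space_def A_RCOSETS_def' N.a_rcos_sum)

lemma coset_eq_iff:
  assumes "v \<in> carrier V" "w \<in> carrier V"
  shows "N +>\<^bsub>V\<^esub> v = N +>\<^bsub>V\<^esub> w \<longleftrightarrow> (\<exists>n\<in>N. v = n \<oplus>\<^bsub>V\<^esub> w)"
proof
  assume "N +>\<^bsub>V\<^esub> v = N +>\<^bsub>V\<^esub> w"
  moreover have "v \<in> N +>\<^bsub>V\<^esub> v" using assms by (simp add: N.a_rcos_self)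
  ultimately show "\<exists>n\<in>N. v = n \<oplus>\<^bsub>V\<^esub> w" by (auto simp: a_r_coset_def')
next
  assume "\<exists>n\<in>N. v = n \<oplus>\<^bsub>V\<^esub> w"
  then have "v \<in> N +>\<^bsub>V\<^esub> w" by (auto simp: a_r_coset_def')
  then show "N +>\<^bsub>V\<^esub> v = N +>\<^bsub>V\<^esub> w"
    using N.a_repr_independence' assms(2) N.a_subgroup by metis
qed

text \<open>The scalar multiple is defined as a union of cosets over all representatives
  \<open>x = n \<oplus> v\<close>. All these cosets coincide, since \<open>c \<odot> x\<close> and
  \<open>c \<odot> v\<close> differ by \<open>c \<odot> n\<close>, which lies in
  \<open>N\<close>.\<close>

lemma quotient_smult:
  assumes v: "v \<in> carrier V"
  shows "c \<odot>\<^bsub>quotient_space V N\<^esub> (N +>\<^bsub>V\<^esub> v) = N +>\<^bsub>V\<^esub> (c \<odot>\<^bsub>V\<^esub> v)"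
proof -
  have *: "N +>\<^bsub>V\<^esub> (c \<odot>\<^bsub>V\<^esub> x) = N +>\<^bsub>V\<^esub> (c \<odot>\<^bsub>V\<^esub> v)" if x: "x \<in> N +>\<^bsub>V\<^esub> v" for x
  proof -
    obtain n where n: "n \<in> N" "x = n \<oplus>\<^bsub>V\<^esub> v" using x by (auto simp: a_r_coset_def')
    have "n \<in> carrier V" using n subspaceD(2)[OF N] by auto
    then show ?thesis
      using n v subspaceD(5)[OF N n(1)]
      by (subst coset_eq_iff) (auto simp: vectorspaceD[OF subspaceD(1)[OF N]])
  qed
  have "v \<in> N +>\<^bsub>V\<^esub> v" using v by (simp add: N.a_rcos_self)
  then have "(\<Union>x\<in>N +>\<^bsub>V\<^esub> v. N +>\<^bsub>V\<^esub> (c \<odot>\<^bsub>V\<^esub> x)) = N +>\<^bsub>V\<^esub> (c \<odot>\<^bsub>V\<^esub> v)"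
    using * by blast
  then show ?thesis by (simp add: quotient_space_def)
qed

lemma vectorspace_quotient_space: "vectorspace class_ring (quotient_space V N)"
proof -
  note VD = vectorspaceD[OF subspaceD(1)[OF N]]
  \<comment> \<open>The zero of the quotient is \<open>N\<close> itself; it has to be written as a
    coset before the rules for cosets apply to it.\<close>
  have zero: "N = N +>\<^bsub>V\<^esub> \<zero>\<^bsub>V\<^esub>" using subspaceD(2)[OF N] by simp
  have zero_carrier: "\<exists>v\<in>carrier V. N = N +>\<^bsub>V\<^esub> v" using zero VD(1) by blast
  show ?thesis
  proof (rule vectorspace_criteria)
    fix X assume X: "X \<in> carrier (quotient_space V N)"
    then obtain v where v: "v \<in> carrier V" "X = N +>\<^bsub>V\<^esub> v"
      by (auto simp: quotient_simps)
    have "X \<oplus>\<^bsub>quotient_space V N\<^esub> (N +>\<^bsub>V\<^esub> \<zero>\<^bsub>V\<^esub>) = X"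
      using v VD(1) by (simp only: quotient_simps VD)
    then show "X \<oplus>\<^bsub>quotient_space V N\<^esub> \<zero>\<^bsub>quotient_space V N\<^esub> = X"
      by (simp only: quotient_simps zero[symmetric])
    have "(-1) \<odot>\<^bsub>V\<^esub> v \<oplus>\<^bsub>V\<^esub> v = (-1) \<odot>\<^bsub>V\<^esub> v \<oplus>\<^bsub>V\<^esub> 1 \<odot>\<^bsub>V\<^esub> v"
      using v by (simp only: VD)
    also have "\<dots> = \<zero>\<^bsub>V\<^esub>" using v by (simp add: VD(4) flip: VD(10))
    finally show "(-1) \<odot>\<^bsub>quotient_space V N\<^esub> X \<oplus>\<^bsub>quotient_space V N\<^esub> X = \<zero>\<^bsub>quotient_space V N\<^esub>"
      using v VD(3)[OF v(1)] by (simp only: quotient_simps quotient_smult zero[symmetric])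
    show "(c + d) \<odot>\<^bsub>quotient_space V N\<^esub> X =
        c \<odot>\<^bsub>quotient_space V N\<^esub> X \<oplus>\<^bsub>quotient_space V N\<^esub> d \<odot>\<^bsub>quotient_space V N\<^esub> X"
      "(c * d) \<odot>\<^bsub>quotient_space V N\<^esub> X = c \<odot>\<^bsub>quotient_space V N\<^esub> (d \<odot>\<^bsub>quotient_space V N\<^esub> X)"
      "1 \<odot>\<^bsub>quotient_space V N\<^esub> X = X"
      "c \<odot>\<^bsub>quotient_space V N\<^esub> X \<in> carrier (quotient_space V N)" for c d
      using v VD(3)[OF v(1)] by (auto simp: quotient_simps quotient_smult VD)
    fix Y assume "Y \<in> carrier (quotient_space V N)"
    then obtain w where w: "w \<in> carrier V" "Y = N +>\<^bsub>V\<^esub> w"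
      by (auto simp: quotient_simps)
    show "X \<oplus>\<^bsub>quotient_space V N\<^esub> Y \<in> carrier (quotient_space V N)"
      "X \<oplus>\<^bsub>quotient_space V N\<^esub> Y = Y \<oplus>\<^bsub>quotient_space V N\<^esub> X"
      "c \<odot>\<^bsub>quotient_space V N\<^esub> (X \<oplus>\<^bsub>quotient_space V N\<^esub> Y) =
        c \<odot>\<^bsub>quotient_space V N\<^esub> X \<oplus>\<^bsub>quotient_space V N\<^esub> c \<odot>\<^bsub>quotient_space V N\<^esub> Y" for c
      using v w by (auto simp: quotient_simps quotient_smult VD V.a_comm)
    fix Z assume "Z \<in> carrier (quotient_space V N)"
    then show "X \<oplus>\<^bsub>quotient_space V N\<^esub> Y \<oplus>\<^bsub>quotient_space V N\<^esub> Z =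
        X \<oplus>\<^bsub>quotient_space V N\<^esub> (Y \<oplus>\<^bsub>quotient_space V N\<^esub> Z)"
      using v w by (auto simp: quotient_simps V.a_assoc)
  qed (use zero_carrier in \<open>auto simp: quotient_simps\<close>)
qed

lemma quotient_descend:
  assumes T: "lin_map V U T" and "\<And>n. n \<in> N \<Longrightarrow> T n = \<zero>\<^bsub>U\<^esub>"
  obtains T' where "lin_map (quotient_space V N) U T'"
    "\<And>v. v \<in> carrier V \<Longrightarrow> T' (N +>\<^bsub>V\<^esub> v) = T v"
proof -
  \<comment> \<open>The chosen representative is immaterial: two representatives of a coset differ
    by an element of \<open>N\<close>, which \<open>T\<close> sends to zero.\<close>
  define T' where "T' X = T (SOME v. v \<in> carrier V \<and> X = N +>\<^bsub>V\<^esub> v)" for X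
  note VD = vectorspaceD[OF subspaceD(1)[OF N]] and TD = lin_mapD[OF T]
  have eq: "T' (N +>\<^bsub>V\<^esub> v) = T v" if v: "v \<in> carrier V" for v
  proof -
    define w where "w = (SOME w. w \<in> carrier V \<and> N +>\<^bsub>V\<^esub> v = N +>\<^bsub>V\<^esub> w)"
    have "w \<in> carrier V \<and> N +>\<^bsub>V\<^esub> v = N +>\<^bsub>V\<^esub> w"
      unfolding w_def using v by (rule_tac someI[of _ v]) simp
    moreover from this obtain n where "n \<in> N" "v = n \<oplus>\<^bsub>V\<^esub> w" using coset_eq_iff v by blast
    ultimately have "T v = T w" using assms(2) subspaceD(2)[OF N] by (auto simp: TD vectorspaceD[OF TD(2)])
    then show ?thesis by (simp add: T'_def w_def)
  qed
  show thesis
  proof (rule that[OF lin_mapI[OF vectorspace_quotient_space lin_mapD(2)[OF T]] eq])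
  qed (auto simp: quotient_simps quotient_smult eq TD VD)
qed

end

section \<open>Tensor products and their universal property\<close>

locale balanced_pair =
  fixes M :: "(complex, 'm) module" and R :: "'r set" and ra :: "'m \<Rightarrow> 'r \<Rightarrow> 'm"
    and la :: "'r \<Rightarrow> 'n \<Rightarrow> 'n" and N :: "(complex, 'n) module"
  assumes M: "vectorspace class_ring M" and N: "vectorspace class_ring N"
    and ra_closed: "a \<in> carrier M \<Longrightarrow> r \<in> R \<Longrightarrow> ra a r \<in> carrier M"
    and la_closed: "r \<in> R \<Longrightarrow> w \<in> carrier N \<Longrightarrow> la r w \<in> carrier N"
begin

abbreviation F where "F \<equiv> free_space (carrier M \<times> carrier N)"
abbreviation rel where "rel \<equiv> tensor_relations M R ra la N"
abbreviation pt where "pt \<equiv> pure_tensor M R ra la N"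
abbreviation T where "T \<equiv> tensor_space M R ra la N"

text \<open>A name for the generating set inside \<open>tensor_relations\<close>. Each generator is
  a difference whose membership here identifies two cosets (\<open>coset_eqI\<close>).\<close>

definition gens :: "('m \<times> 'n \<Rightarrow> complex) set" where
  "gens =
    {delta (a \<oplus>\<^bsub>M\<^esub> b, w) \<ominus>\<^bsub>F\<^esub> (delta (a, w) \<oplus>\<^bsub>F\<^esub> delta (b, w)) | a b w.
       a \<in> carrier M \<and> b \<in> carrier M \<and> w \<in> carrier N} \<union>
    {delta (a, v \<oplus>\<^bsub>N\<^esub> w) \<ominus>\<^bsub>F\<^esub> (delta (a, v) \<oplus>\<^bsub>F\<^esub> delta (a, w)) | a v w.
       a \<in> carrier M \<and> v \<in> carrier N \<and> w \<in> carrier N} \<union>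
    {delta (ra a r, w) \<ominus>\<^bsub>F\<^esub> delta (a, la r w) | a r w.
       a \<in> carrier M \<and> r \<in> R \<and> w \<in> carrier N} \<union>
    {delta (c \<odot>\<^bsub>M\<^esub> a, w) \<ominus>\<^bsub>F\<^esub> (c \<odot>\<^bsub>F\<^esub> delta (a, w)) | c a w.
       a \<in> carrier M \<and> w \<in> carrier N}"

lemma relations_eq: "rel = LinearCombinations.module.span class_ring F gens"
  by (simp only: tensor_relations_def gens_def Let_def)

lemmas FD = vectorspaceD[OF vectorspace_free_space[of "carrier M \<times> carrier N"]]

lemma delta_closed: "a \<in> carrier M \<Longrightarrow> w \<in> carrier N \<Longrightarrow> delta (a, w) \<in> carrier F"
  by (intro delta_in_free_space) simp

lemma minus_closed: "f \<in> carrier F \<Longrightarrow> g \<in> carrier F \<Longrightarrow> f \<ominus>\<^bsub>F\<^esub> g \<in> carrier F"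
proof -
  interpret F: vectorspace class_ring F by (rule vectorspace_free_space)
  show "f \<in> carrier F \<Longrightarrow> g \<in> carrier F \<Longrightarrow> f \<ominus>\<^bsub>F\<^esub> g \<in> carrier F" by simp
qed

lemma gens_subset: "gens \<subseteq> carrier F"
  unfolding gens_def
  using vectorspaceD(2,3)[OF M] vectorspaceD(2)[OF N] ra_closed la_closed
  by (intro Un_least; clarsimp; intro minus_closed FD delta_closed) auto

lemma subspace_relations: "subspace class_ring rel F"
proof -
  interpret F: vectorspace class_ring F by (rule vectorspace_free_space)
  show ?thesis unfolding relations_eq using gens_subset by (rule F.span_is_subspace)
qed

lemma gens_in_relations: "gens \<subseteq> rel"
proof -
  interpret F: vectorspace class_ring F by (rule vectorspace_free_space)
  show ?thesis unfolding relations_eq using gens_subset by (rule F.in_own_span)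
qed

lemma relations_least:
  assumes "subspace class_ring S F" "gens \<subseteq> S"
  shows "rel \<subseteq> S"
proof -
  interpret F: vectorspace class_ring F by (rule vectorspace_free_space)
  show ?thesis unfolding relations_eq using assms by (intro F.span_is_subset) (auto simp: subspace_def)
qed

lemma tensor_space_eq: "T = quotient_space F rel"
  by (simp add: tensor_space_def)

lemma vectorspace_tensor: "vectorspace class_ring T"
  unfolding tensor_space_eq by (rule vectorspace_quotient_space[OF subspace_relations])

lemmas quot = quotient_simps[OF subspace_relations, folded tensor_space_eq]
  quotient_smult[OF subspace_relations, folded tensor_space_eq]

lemma pt_closed: "a \<in> carrier M \<Longrightarrow> w \<in> carrier N \<Longrightarrow> pt a w \<in> carrier T"
  unfolding pure_tensor_def quot using delta_closed by blast

lemma coset_eqI: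
  assumes "f \<in> carrier F" "g \<in> carrier F" "f \<ominus>\<^bsub>F\<^esub> g \<in> gens"
  shows "rel +>\<^bsub>F\<^esub> f = rel +>\<^bsub>F\<^esub> g"
proof (subst coset_eq_iff[OF subspace_relations assms(1,2)], rule bexI)
  show "f = f \<ominus>\<^bsub>F\<^esub> g \<oplus>\<^bsub>F\<^esub> g"
    by (simp add: free_space_minus[OF assms(1,2)] free_space_simps)
qed (use assms gens_in_relations in blast)

lemma pt_add_left:
  assumes "a \<in> carrier M" "b \<in> carrier M" "w \<in> carrier N"
  shows "pt (a \<oplus>\<^bsub>M\<^esub> b) w = pt a w \<oplus>\<^bsub>T\<^esub> pt b w"
  unfolding pure_tensor_def
  using assms vectorspaceD(2)[OF M]
  by (subst quot; (intro coset_eqI FD)?) (auto simp: delta_closed gens_def)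

lemma pt_add_right:
  assumes "a \<in> carrier M" "v \<in> carrier N" "w \<in> carrier N"
  shows "pt a (v \<oplus>\<^bsub>N\<^esub> w) = pt a v \<oplus>\<^bsub>T\<^esub> pt a w"
  unfolding pure_tensor_def
  using assms vectorspaceD(2)[OF N]
  by (subst quot; (intro coset_eqI FD)?) (auto simp: delta_closed gens_def)

lemma pt_balanced:
  assumes "a \<in> carrier M" "r \<in> R" "w \<in> carrier N"
  shows "pt (ra a r) w = pt a (la r w)"
  unfolding pure_tensor_def
  using assms ra_closed la_closed
  by (intro coset_eqI) (auto simp: delta_closed gens_def)

lemma pt_smult:
  assumes "a \<in> carrier M" "w \<in> carrier N"
  shows "pt (c \<odot>\<^bsub>M\<^esub> a) w = c \<odot>\<^bsub>T\<^esub> pt a w"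
  unfolding pure_tensor_def
  using assms vectorspaceD(3)[OF M]
  by (subst quot; (intro coset_eqI FD)?) (auto simp: delta_closed gens_def)

text \<open>Two cases suffice because scalars are absorbed by the first factor: a multiple of a pure
  tensor is again pure. In particular the zero vector is 0 times a pure tensor.\<close>

lemma tensor_induct [consumes 1, case_names pure add]:
  assumes "t \<in> carrier T"
    and pure: "\<And>a w. a \<in> carrier M \<Longrightarrow> w \<in> carrier N \<Longrightarrow> P (pt a w)"
    and add: "\<And>s t. s \<in> carrier T \<Longrightarrow> t \<in> carrier T \<Longrightarrow> P s \<Longrightarrow> P t \<Longrightarrow> P (s \<oplus>\<^bsub>T\<^esub> t)"
  shows "P t"
proof -
  have smult: "P (rel +>\<^bsub>F\<^esub> (c \<odot>\<^bsub>F\<^esub> delta p))" if "p \<in> carrier M \<times> carrier N" for c p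
  proof -
    obtain a w where p: "p = (a, w)" "a \<in> carrier M" "w \<in> carrier N" using \<open>p \<in> _\<close> by auto
    have "rel +>\<^bsub>F\<^esub> (c \<odot>\<^bsub>F\<^esub> delta p) = pt (c \<odot>\<^bsub>M\<^esub> a) w"
      using p by (simp add: pt_smult) (simp add: pure_tensor_def quot delta_closed)
    then show ?thesis using p pure vectorspaceD(3)[OF M] by simp
  qed
  have "P (rel +>\<^bsub>F\<^esub> f)" if "f \<in> carrier F" for f
    using that
  proof (induction rule: free_space_induct)
    case zero
    have "(\<zero>\<^bsub>M\<^esub>, \<zero>\<^bsub>N\<^esub>) \<in> carrier M \<times> carrier N"
      using vectorspaceD(1)[OF M] vectorspaceD(1)[OF N] by simp
    from smult[OF this, of 0] show ?case by (simp add: free_space_simps)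
  next
    case (add f g)
    then have "P ((rel +>\<^bsub>F\<^esub> f) \<oplus>\<^bsub>T\<^esub> (rel +>\<^bsub>F\<^esub> g))"
      by (intro assms(3)) (auto simp: quot)
    then show ?case using add by (simp add: quot)
  qed (rule smult)
  then show ?thesis using assms(1) by (auto simp: quot)
qed

text \<open>The extension \<open>E\<close> of \<open>\<beta>\<close> to the free space kills every
  generator, one hypothesis being responsible for each of the four kinds of relations. Its kernel is
  a subspace, so it contains the whole span \<open>rel\<close>, and \<open>E\<close> descends to the
  quotient.\<close>

lemma tensor_universal:
  fixes U :: "(complex, 'u) module"
  assumes U: "vectorspace class_ring U"
    and closed: "\<And>a w. a \<in> carrier M \<Longrightarrow> w \<in> carrier N \<Longrightarrow> \<beta> a w \<in> carrier U"
    and add_left: "\<And>a b w. a \<in> carrier M \<Longrightarrow> b \<in> carrier M \<Longrightarrow> w \<in> carrier N \<Longrightarrow>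
      \<beta> (a \<oplus>\<^bsub>M\<^esub> b) w = \<beta> a w \<oplus>\<^bsub>U\<^esub> \<beta> b w"
    and add_right: "\<And>a v w. a \<in> carrier M \<Longrightarrow> v \<in> carrier N \<Longrightarrow> w \<in> carrier N \<Longrightarrow>
      \<beta> a (v \<oplus>\<^bsub>N\<^esub> w) = \<beta> a v \<oplus>\<^bsub>U\<^esub> \<beta> a w"
    and balanced: "\<And>a r w. a \<in> carrier M \<Longrightarrow> r \<in> R \<Longrightarrow> w \<in> carrier N \<Longrightarrow>
      \<beta> (ra a r) w = \<beta> a (la r w)"
    and smult: "\<And>c a w. a \<in> carrier M \<Longrightarrow> w \<in> carrier N \<Longrightarrow> \<beta> (c \<odot>\<^bsub>M\<^esub> a) w = c \<odot>\<^bsub>U\<^esub> \<beta> a w"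
  obtains L where "lin_map T U L"
    "\<And>a w. a \<in> carrier M \<Longrightarrow> w \<in> carrier N \<Longrightarrow> L (pt a w) = \<beta> a w"
proof -
  interpret U: vectorspace class_ring U by fact
  define E where "E = free_extension U (\<lambda>(a, w). \<beta> a w)"
  have E: "lin_map F U E"
    unfolding E_def by (rule lin_map_free_extension[OF U]) (auto simp: closed)
  have E_delta: "E (delta (a, w)) = \<beta> a w" if "a \<in> carrier M" "w \<in> carrier N" for a w
    unfolding E_def using that by (simp add: free_extension_delta[OF U] closed)
  interpret E: linear_map class_ring F U E by (rule E)
  have zero: "subspace class_ring {\<zero>\<^bsub>U\<^esub>} U"
    by (rule subspaceI[OF U]) (auto simp: vectorspaceD[OF U])
  have minus: "E (f \<ominus>\<^bsub>F\<^esub> g) = \<zero>\<^bsub>U\<^esub>" if "f \<in> carrier F" "g \<in> carrier F" "E f = E g" for f g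
    using that by (simp add: U.r_neg a_minus_def)
  have "gens \<subseteq> {f \<in> carrier F. E f \<in> {\<zero>\<^bsub>U\<^esub>}}"
  proof (rule subsetI, rule CollectI, rule conjI)
    fix f assume f: "f \<in> gens"
    then show "f \<in> carrier F" using gens_subset by blast
    show "E f \<in> {\<zero>\<^bsub>U\<^esub>}"
      using f unfolding gens_def singleton_iff
      using vectorspaceD(2,3)[OF M] vectorspaceD(2)[OF N] ra_closed la_closed
      by (elim UnE CollectE exE conjE; hypsubst; intro minus FD delta_closed)
        (auto simp: lin_mapD(4,5)[OF E] E_delta delta_closed add_left add_right balanced smult FD(2,3))
  qed
  then have "rel \<subseteq> {f \<in> carrier F. E f \<in> {\<zero>\<^bsub>U\<^esub>}}"
    by (rule relations_least[OF subspace_vimage[OF E zero]])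
  then have "E n = \<zero>\<^bsub>U\<^esub>" if "n \<in> rel" for n using that by auto
  then obtain L where L: "lin_map T U L" "\<And>f. f \<in> carrier F \<Longrightarrow> L (rel +>\<^bsub>F\<^esub> f) = E f"
    using quotient_descend[OF subspace_relations E] unfolding tensor_space_eq by blast
  show thesis
    by (rule that[OF L(1)]) (simp add: pure_tensor_def L(2) delta_closed E_delta)
qed

end

section \<open>Induced representations\<close>

lemma lin_map_restrict:
  assumes "lin_map V W T"
  shows "lin_map V W (restrict T (carrier V))"
  by (rule lin_mapI) (simp_all add: lin_mapD[OF assms] vectorspaceD[OF lin_mapD(1)[OF assms]])

text \<open>\<open>linear_extension\<close> is a definite description. The restriction of
  \<open>L\<close> witnesses existence, and \<open>unique\<close> says that the generators determine
  a linear map. Both group actions are computed through this lemma.\<close>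

lemma linear_extension_eqI:
  assumes L: "lin_map V W L"
    and gen: "\<And>i. i \<in> I \<Longrightarrow> gen i \<in> carrier V" "\<And>i. i \<in> I \<Longrightarrow> L (gen i) = img i"
    and unique: "\<And>T v. lin_map V W T \<Longrightarrow> (\<And>i. i \<in> I \<Longrightarrow> T (gen i) = L (gen i)) \<Longrightarrow>
      v \<in> carrier V \<Longrightarrow> T v = L v"
  shows "linear_extension V W I gen img = restrict L (carrier V)"
  unfolding linear_extension_def
proof (rule the_equality)
  show "restrict L (carrier V) \<in> extensional (carrier V) \<and> lin_map V W (restrict L (carrier V)) \<and>
      (\<forall>i\<in>I. restrict L (carrier V) (gen i) = img i)"
    using lin_map_restrict[OF L] gen by simp
  fix T assume T: "T \<in> extensional (carrier V) \<and> lin_map V W T \<and> (\<forall>i\<in>I. T (gen i) = img i)"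
  then have "T v = L v" if "v \<in> carrier V" for v
    using that gen by (auto intro: unique[of T v])
  then show "T = restrict L (carrier V)"
    using T by (intro extensionalityI[of _ "carrier V"]) auto
qed

locale induction_data = group G for G :: "('g, 'm) monoid_scheme" (structure) +
  fixes K :: "'g set" and W :: "(complex, 'w) module" and \<sigma> :: "'g \<Rightarrow> 'w \<Rightarrow> 'w"
  assumes finite_G: "finite (carrier G)" and K: "subgroup K G"
    and rep: "group_rep (G\<lparr>carrier := K\<rparr>) W \<sigma>"
begin

abbreviation GA where "GA \<equiv> group_algebra G"
abbreviation KA where "KA \<equiv> carrier (group_algebra (G\<lparr>carrier := K\<rparr>))"
abbreviation V where "V \<equiv> ind_space G K W \<sigma>"

text \<open>Tensors with a group element on the left suffice for all later arguments.
  \<open>ind_induct\<close> shows that they generate, and \<open>ind_universal\<close> that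
  additivity, homogeneity and \<open>t_translate\<close> are the only relations among them.\<close>

definition t :: "'g \<Rightarrow> 'w \<Rightarrow> ('g, 'w) ind_vec" where
  "t x w = ind_tensor G K W \<sigma> (delta x) w"

lemma K_subset: "k \<in> K \<Longrightarrow> k \<in> carrier G"
  using subgroup.subset[OF K] by auto

lemma finite_K: "finite K"
  using finite_subset[OF subgroup.subset[OF K] finite_G] .

lemma W: "vectorspace class_ring W"
  using rep by (simp add: group_rep_def fd_space_def)

lemma \<sigma>_lin: "k \<in> K \<Longrightarrow> lin_map W W (\<sigma> k)"
  using rep by (simp add: group_rep_def)

lemmas \<sigma>_closed = lin_mapD(3)[OF \<sigma>_lin]

lemma \<sigma>_one: "w \<in> carrier W \<Longrightarrow> \<sigma> \<one> w = w"
  and \<sigma>_mult: "k \<in> K \<Longrightarrow> l \<in> K \<Longrightarrow> w \<in> carrier W \<Longrightarrow> \<sigma> (k \<otimes> l) w = \<sigma> k (\<sigma> l w)"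
  using rep by (simp_all add: group_rep_def)

lemmas WD = vectorspaceD[OF W]

section \<open>The group algebra and the action of the subalgebra of \<open>K\<close> on
  \<open>W\<close>\<close>

lemma carrier_GA: "carrier GA = carrier (free_space (carrier G))"
  by (auto simp: group_algebra_def free_space_def intro!: finite_subset[OF _ finite_G])

lemma carrier_KA: "KA = carrier (free_space K)"
  by (auto simp: group_algebra_def free_space_def intro!: finite_subset[OF _ finite_K])

lemma GA_simps:
  "\<zero>\<^bsub>GA\<^esub> = (\<lambda>_. 0)"
  "a \<oplus>\<^bsub>GA\<^esub> b = (\<lambda>x. a x + b x)"
  "c \<odot>\<^bsub>GA\<^esub> a = (\<lambda>x. c * a x)"
  by (simp_all add: group_algebra_def)

lemma vectorspace_GA: "vectorspace class_ring GA"
  by (rule vectorspace_criteria) (auto simp: group_algebra_def algebra_simps)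

lemma delta_GA: "x \<in> carrier G \<Longrightarrow> delta x \<in> carrier GA"
  by (auto simp: group_algebra_def delta_def)

text \<open>As \<open>G\<close> is finite, the group algebra is the free space on \<open>G\<close>.
  The zero case of \<open>free_space_induct\<close> is covered by 0 times the unit element.\<close>

lemma GA_induct [consumes 1, case_names delta add]:
  assumes "a \<in> carrier GA"
    and delta: "\<And>c x. x \<in> carrier G \<Longrightarrow> P (c \<odot>\<^bsub>GA\<^esub> delta x)"
    and add: "\<And>a b. a \<in> carrier GA \<Longrightarrow> b \<in> carrier GA \<Longrightarrow> P a \<Longrightarrow> P b \<Longrightarrow> P (a \<oplus>\<^bsub>GA\<^esub> b)"
  shows "P a"
  using assms(1) unfolding carrier_GA
proof (induction rule: free_space_induct)
  case zero
  show ?case using delta[of \<one> 0] by (simp add: GA_simps)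
qed (use delta add in \<open>auto simp: GA_simps free_space_simps(3,4) carrier_GA\<close>)

lemma conv_closed: "a \<otimes>\<^bsub>GA\<^esub> b \<in> carrier GA"
  by (simp add: group_algebra_def)

lemma conv_add_left: "(a \<oplus>\<^bsub>GA\<^esub> b) \<otimes>\<^bsub>GA\<^esub> c = a \<otimes>\<^bsub>GA\<^esub> c \<oplus>\<^bsub>GA\<^esub> b \<otimes>\<^bsub>GA\<^esub> c"
  by (auto simp: group_algebra_def sum.distrib algebra_simps)

lemma conv_add_right: "a \<otimes>\<^bsub>GA\<^esub> (b \<oplus>\<^bsub>GA\<^esub> c) = a \<otimes>\<^bsub>GA\<^esub> b \<oplus>\<^bsub>GA\<^esub> a \<otimes>\<^bsub>GA\<^esub> c"
  by (auto simp: group_algebra_def sum.distrib algebra_simps)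

lemma conv_smult_left: "(c \<odot>\<^bsub>GA\<^esub> a) \<otimes>\<^bsub>GA\<^esub> b = c \<odot>\<^bsub>GA\<^esub> (a \<otimes>\<^bsub>GA\<^esub> b)"
  by (auto simp: group_algebra_def sum_distrib_left algebra_simps)

lemma conv_smult_right: "a \<otimes>\<^bsub>GA\<^esub> (c \<odot>\<^bsub>GA\<^esub> b) = c \<odot>\<^bsub>GA\<^esub> (a \<otimes>\<^bsub>GA\<^esub> b)"
  by (auto simp: group_algebra_def sum_distrib_left algebra_simps)

text \<open>Only \<open>u = x\<close> contributes to the convolution sum at \<open>z\<close>, and
  \<open>inv x \<otimes> z = y\<close> says that \<open>z = x \<otimes> y\<close>.\<close>

lemma conv_delta:
  assumes "x \<in> carrier G" "y \<in> carrier G"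
  shows "delta x \<otimes>\<^bsub>GA\<^esub> delta y = delta (x \<otimes> y)"
proof
  fix z
  have "(\<Sum>u\<in>carrier G. delta x u * delta y (inv u \<otimes> z)) = (\<Sum>u\<in>{x}. delta y (inv u \<otimes> z))"
    using assms finite_G by (intro sum.mono_neutral_cong_right) (auto simp: delta_def)
  moreover have "inv x \<otimes> z = y \<longleftrightarrow> z = x \<otimes> y" if "z \<in> carrier G"
    using assms that inv_solve_left' by auto
  ultimately show "(delta x \<otimes>\<^bsub>GA\<^esub> delta y) z = delta (x \<otimes> y) z"
    using assms by (auto simp: group_algebra_def delta_def)
qed

abbreviation la where "la \<equiv> group_algebra_action K W \<sigma>"

lemma la_summand: "w \<in> carrier W \<Longrightarrow> (\<lambda>k. r k \<odot>\<^bsub>W\<^esub> \<sigma> k w) \<in> K \<rightarrow> carrier W"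
  by (auto intro!: WD \<sigma>_closed)

lemma la_in_W: "w \<in> carrier W \<Longrightarrow> la r w \<in> carrier W"
proof -
  interpret W: vectorspace class_ring W by (rule W)
  assume "w \<in> carrier W"
  then show ?thesis
    unfolding group_algebra_action_def by (intro W.finsum_closed la_summand)
qed

lemma la_add:
  assumes "w \<in> carrier W"
  shows "la (\<lambda>k. r k + s k) w = la r w \<oplus>\<^bsub>W\<^esub> la s w"
proof -
  interpret W: vectorspace class_ring W by (rule W)
  have "la (\<lambda>k. r k + s k) w = (\<Oplus>\<^bsub>W\<^esub>k\<in>K. r k \<odot>\<^bsub>W\<^esub> \<sigma> k w \<oplus>\<^bsub>W\<^esub> s k \<odot>\<^bsub>W\<^esub> \<sigma> k w)"
    unfolding group_algebra_action_def using assms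
    by (intro W.finsum_cong') (auto intro!: WD \<sigma>_closed)
  also have "\<dots> = la r w \<oplus>\<^bsub>W\<^esub> la s w"
    unfolding group_algebra_action_def using assms
    by (intro W.finsum_addf la_summand)
  finally show ?thesis .
qed

lemma la_smult_delta:
  assumes "w \<in> carrier W" "k \<in> K"
  shows "la (\<lambda>x. c * delta k x) w = c \<odot>\<^bsub>W\<^esub> \<sigma> k w"
proof -
  interpret W: vectorspace class_ring W by (rule W)
  have "la (\<lambda>x. c * delta k x) w = (\<Oplus>\<^bsub>W\<^esub>l\<in>K. if k = l then c \<odot>\<^bsub>W\<^esub> \<sigma> l w else \<zero>\<^bsub>W\<^esub>)"
    unfolding group_algebra_action_def using assms
    by (intro W.finsum_cong') (auto simp: delta_def WD \<sigma>_closed)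
  also have "\<dots> = c \<odot>\<^bsub>W\<^esub> \<sigma> k w"
    using assms finite_K by (intro W.finsum_singleton) (auto intro!: WD \<sigma>_closed)
  finally show ?thesis .
qed

sublocale balanced_pair GA KA "mult GA" la W
  by (rule balanced_pair.intro) (simp_all add: vectorspace_GA W la_in_W conv_closed)

section \<open>Generators and universal property of the induced representation\<close>

lemma ind_space_eq: "V = T"
  by (simp add: ind_space_def)

lemma ind_tensor_eq: "ind_tensor G K W \<sigma> = pt"
  by (simp add: ind_tensor_def)

lemma V: "vectorspace class_ring V"
  unfolding ind_space_eq by (rule vectorspace_tensor)

lemmas VD = vectorspaceD[OF V]

lemma delta_KA: "k \<in> K \<Longrightarrow> (\<lambda>x. c * delta k x) \<in> KA"
  by (auto simp: group_algebra_def delta_def)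

lemma t_closed: "x \<in> carrier G \<Longrightarrow> w \<in> carrier W \<Longrightarrow> t x w \<in> carrier V"
  by (simp add: t_def ind_space_eq ind_tensor_eq pt_closed delta_GA)

lemma t_add: "x \<in> carrier G \<Longrightarrow> v \<in> carrier W \<Longrightarrow> w \<in> carrier W \<Longrightarrow>
    t x (v \<oplus>\<^bsub>W\<^esub> w) = t x v \<oplus>\<^bsub>V\<^esub> t x w"
  by (simp add: t_def ind_space_eq ind_tensor_eq pt_add_right delta_GA)

text \<open>Balancedness applied to the element \<open>c\<close> times \<open>delta k\<close> of the
  subalgebra, which acts on \<open>W\<close> as \<open>\<sigma> k\<close> followed by scaling with
  \<open>c\<close>. Taking \<open>k = \<one>\<close> yields homogeneity in the second factor, and
  \<open>c = 1\<close> yields the translation rule.\<close>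

lemma t_smult_translate:
  assumes "x \<in> carrier G" "k \<in> K" "w \<in> carrier W"
  shows "t x (c \<odot>\<^bsub>W\<^esub> \<sigma> k w) = c \<odot>\<^bsub>V\<^esub> t (x \<otimes> k) w"
proof -
  have "t x (c \<odot>\<^bsub>W\<^esub> \<sigma> k w) = pt (delta x \<otimes>\<^bsub>GA\<^esub> (c \<odot>\<^bsub>GA\<^esub> delta k)) w"
    using assms by (simp add: t_def ind_tensor_eq pt_balanced delta_GA delta_KA la_smult_delta GA_simps)
  also have "\<dots> = c \<odot>\<^bsub>V\<^esub> t (x \<otimes> k) w"
    using assms K_subset
    by (simp add: conv_smult_right conv_delta pt_smult delta_GA t_def ind_tensor_eq ind_space_eq)
  finally show ?thesis .
qed

lemma t_smult:
  assumes "x \<in> carrier G" "w \<in> carrier W"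
  shows "t x (c \<odot>\<^bsub>W\<^esub> w) = c \<odot>\<^bsub>V\<^esub> t x w"
  using t_smult_translate[of x \<one> w c] assms subgroup.one_closed[OF K] by (simp add: \<sigma>_one)

lemma t_translate:
  assumes "x \<in> carrier G" "k \<in> K" "w \<in> carrier W"
  shows "t (x \<otimes> k) w = t x (\<sigma> k w)"
  using t_smult_translate[of x k w 1] assms K_subset
  by (simp add: WD \<sigma>_closed VD t_closed)

lemma lin_map_t: "x \<in> carrier G \<Longrightarrow> lin_map W V (t x)"
  by (intro lin_mapI W V) (auto simp: t_closed t_add t_smult)

lemmas t_zero = lin_mapD(6)[OF lin_map_t]

text \<open>A general left factor is a sum of multiples of group elements; the sum is split by
  additivity, and each coefficient moves over to \<open>w\<close>.\<close>

lemma ind_induct [consumes 1, case_names tensor add]: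
  assumes "v \<in> carrier V"
    and tensor: "\<And>x w. x \<in> carrier G \<Longrightarrow> w \<in> carrier W \<Longrightarrow> P (t x w)"
    and add: "\<And>u v. u \<in> carrier V \<Longrightarrow> v \<in> carrier V \<Longrightarrow> P u \<Longrightarrow> P v \<Longrightarrow> P (u \<oplus>\<^bsub>V\<^esub> v)"
  shows "P v"
  using assms(1) unfolding ind_space_eq
proof (induction rule: tensor_induct)
  case (pure a w)
  then show ?case
  proof (induction rule: GA_induct)
    case (delta c x)
    have "pt (c \<odot>\<^bsub>GA\<^esub> delta x) w = t x (c \<odot>\<^bsub>W\<^esub> w)"
      using delta by (simp add: t_smult) (simp add: t_def ind_tensor_eq ind_space_eq pt_smult delta_GA)
    then show ?case using delta by (simp add: tensor WD)
  next
    case (add a b)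
    then show ?case using assms(3) by (simp add: pt_add_left pt_closed ind_space_eq)
  qed
next
  case (add u v)
  then show ?case using assms(3) by (simp add: ind_space_eq)
qed

lemma lin_map_eqI:
  assumes "lin_map V U S" "lin_map V U S'"
    and "\<And>x w. x \<in> carrier G \<Longrightarrow> w \<in> carrier W \<Longrightarrow> S (t x w) = S' (t x w)"
    and "v \<in> carrier V"
  shows "S v = S' v"
  using assms(4)
  by (induction rule: ind_induct)
    (simp_all add: assms(3) lin_mapD(4)[OF assms(1)] lin_mapD(4)[OF assms(2)])

text \<open>The bilinear map behind \<open>L\<close> sends \<open>(a, w)\<close> to the sum of
  \<open>a x \<odot> \<theta> x w\<close> over all \<open>x\<close> in \<open>G\<close>.
  Balancedness over the subalgebra of \<open>K\<close> is linear in both algebra elements, and for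
  group elements it is the hypothesis \<open>translate\<close>.\<close>

lemma ind_universal:
  fixes U :: "(complex, 'u) module"
  assumes lin: "\<And>x. x \<in> carrier G \<Longrightarrow> lin_map W U (\<theta> x)"
    and translate: "\<And>x k w. x \<in> carrier G \<Longrightarrow> k \<in> K \<Longrightarrow> w \<in> carrier W \<Longrightarrow>
      \<theta> (x \<otimes> k) w = \<theta> x (\<sigma> k w)"
  obtains L where "lin_map V U L"
    "\<And>x w. x \<in> carrier G \<Longrightarrow> w \<in> carrier W \<Longrightarrow> L (t x w) = \<theta> x w"
proof -
  have U: "vectorspace class_ring U" by (rule lin_mapD(2)[OF lin[OF one_closed]])
  interpret U: vectorspace class_ring U by (rule U)
  note UD = vectorspaceD[OF U] and lin' = lin_mapD[OF lin]
  define \<beta> where "\<beta> a w = (\<Oplus>\<^bsub>U\<^esub>x\<in>carrier G. a x \<odot>\<^bsub>U\<^esub> \<theta> x w)" for a w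
  have summand: "(\<lambda>x. a x \<odot>\<^bsub>U\<^esub> \<theta> x w) \<in> carrier G \<rightarrow> carrier U" if "w \<in> carrier W" for a w
    using that by (auto intro!: UD lin')
  have closed: "\<beta> a w \<in> carrier U" if "w \<in> carrier W" for a w
    unfolding \<beta>_def using that by (intro U.finsum_closed summand)
  have add_left: "\<beta> (a \<oplus>\<^bsub>GA\<^esub> b) w = \<beta> a w \<oplus>\<^bsub>U\<^esub> \<beta> b w" if w: "w \<in> carrier W" for a b w
  proof -
    have "\<beta> (a \<oplus>\<^bsub>GA\<^esub> b) w = (\<Oplus>\<^bsub>U\<^esub>x\<in>carrier G. a x \<odot>\<^bsub>U\<^esub> \<theta> x w \<oplus>\<^bsub>U\<^esub> b x \<odot>\<^bsub>U\<^esub> \<theta> x w)"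
      unfolding \<beta>_def using w by (intro U.finsum_cong') (auto simp: GA_simps UD lin')
    also have "\<dots> = \<beta> a w \<oplus>\<^bsub>U\<^esub> \<beta> b w"
      unfolding \<beta>_def using w by (intro U.finsum_addf summand)
    finally show ?thesis .
  qed
  have add_right: "\<beta> a (v \<oplus>\<^bsub>W\<^esub> w) = \<beta> a v \<oplus>\<^bsub>U\<^esub> \<beta> a w"
    if vw: "v \<in> carrier W" "w \<in> carrier W" for a v w
  proof -
    have "\<beta> a (v \<oplus>\<^bsub>W\<^esub> w) = (\<Oplus>\<^bsub>U\<^esub>x\<in>carrier G. a x \<odot>\<^bsub>U\<^esub> \<theta> x v \<oplus>\<^bsub>U\<^esub> a x \<odot>\<^bsub>U\<^esub> \<theta> x w)"
      unfolding \<beta>_def using vw by (intro U.finsum_cong') (auto simp: UD lin')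
    also have "\<dots> = \<beta> a v \<oplus>\<^bsub>U\<^esub> \<beta> a w"
      unfolding \<beta>_def using vw by (intro U.finsum_addf summand)
    finally show ?thesis .
  qed
  have smult: "\<beta> (c \<odot>\<^bsub>GA\<^esub> a) w = c \<odot>\<^bsub>U\<^esub> \<beta> a w" if w: "w \<in> carrier W" for c a w
  proof -
    have "\<beta> (c \<odot>\<^bsub>GA\<^esub> a) w = (\<Oplus>\<^bsub>U\<^esub>x\<in>carrier G. c \<odot>\<^bsub>U\<^esub> (a x \<odot>\<^bsub>U\<^esub> \<theta> x w))"
      unfolding \<beta>_def using w by (intro U.finsum_cong') (auto simp: GA_simps UD lin')
    also have "\<dots> = c \<odot>\<^bsub>U\<^esub> \<beta> a w"
      unfolding \<beta>_def using w finite_G by (intro U.finsum_smult_ldistr[symmetric] summand) auto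
    finally show ?thesis .
  qed
  have \<beta>_delta: "\<beta> (delta x) w = \<theta> x w" if xw: "x \<in> carrier G" "w \<in> carrier W" for x w
  proof -
    have "\<beta> (delta x) w = (\<Oplus>\<^bsub>U\<^esub>y\<in>carrier G. if x = y then \<theta> y w else \<zero>\<^bsub>U\<^esub>)"
      unfolding \<beta>_def using xw by (intro U.finsum_cong') (auto simp: delta_def UD lin')
    also have "\<dots> = \<theta> x w"
      using xw finite_G by (intro U.finsum_singleton) (auto intro!: lin')
    finally show ?thesis .
  qed
  \<comment> \<open>Balancedness at \<open>c\<close> times \<open>delta k\<close> moves the scalar
    to the second factor, so homogeneity there is established first.\<close>
  have smult_right: "\<beta> a (c \<odot>\<^bsub>W\<^esub> w) = c \<odot>\<^bsub>U\<^esub> \<beta> a w"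
    if a: "a \<in> carrier GA" and w: "w \<in> carrier W" for c a w
    using a
  proof (induction rule: GA_induct)
    case (delta d x)
    then show ?case using w by (simp add: smult \<beta>_delta WD lin' UD delta_GA mult.commute)
  next
    case (add a b)
    then show ?case using w by (simp add: add_left WD UD closed)
  qed
  \<comment> \<open>Induction on \<open>r\<close>, and inside it on \<open>a\<close>, reduces the
    claim to group elements.\<close>
  have balanced: "\<beta> (a \<otimes>\<^bsub>GA\<^esub> r) w = \<beta> a (la r w)"
    if a: "a \<in> carrier GA" and r: "r \<in> KA" and w: "w \<in> carrier W" for a r w
    using r unfolding carrier_KA
  proof (induction rule: free_space_induct)
    case zero
    have "la (\<lambda>x. 0) w = \<zero>\<^bsub>W\<^esub>"
      using la_smult_delta[OF w subgroup.one_closed[OF K], of 0] w by (simp add: WD \<sigma>_one)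
    then have "\<beta> a (la (\<lambda>x. 0) w) = 0 \<odot>\<^bsub>U\<^esub> \<beta> a w"
      using smult_right[OF a w, of 0] w by (simp add: WD)
    moreover have "a \<otimes>\<^bsub>GA\<^esub> (\<lambda>_. 0) = 0 \<odot>\<^bsub>GA\<^esub> a"
      by (auto simp: group_algebra_def)
    ultimately show ?case using w by (simp add: smult)
  next
    case (delta c k)
    have "\<beta> (a \<otimes>\<^bsub>GA\<^esub> delta k) w = \<beta> a (\<sigma> k w)"
      using a
    proof (induction rule: GA_induct)
      case (delta d x)
      then show ?case
        using w \<open>k \<in> K\<close> K_subset
        by (simp add: conv_smult_left conv_delta smult \<beta>_delta translate \<sigma>_closed)
    next
      case (add a b)
      then show ?case using w \<open>k \<in> K\<close> by (simp add: conv_add_left add_left \<sigma>_closed)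
    qed
    moreover have "c \<odot>\<^bsub>free_space K\<^esub> delta k = c \<odot>\<^bsub>GA\<^esub> delta k" "la (c \<odot>\<^bsub>GA\<^esub> delta k) w = c \<odot>\<^bsub>W\<^esub> \<sigma> k w"
      using delta w by (simp_all add: free_space_simps GA_simps la_smult_delta)
    ultimately show ?case
      using delta w a by (simp add: conv_smult_right smult smult_right \<sigma>_closed)
  next
    case (add r s)
    have "r \<oplus>\<^bsub>free_space K\<^esub> s = r \<oplus>\<^bsub>GA\<^esub> s" "la (r \<oplus>\<^bsub>GA\<^esub> s) w = la r w \<oplus>\<^bsub>W\<^esub> la s w"
      using w by (simp_all add: free_space_simps GA_simps la_add)
    then show ?case using add w a by (simp add: conv_add_right add_left add_right la_in_W)
  qed
  obtain L where L: "lin_map T U L"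
    "\<And>a w. a \<in> carrier GA \<Longrightarrow> w \<in> carrier W \<Longrightarrow> L (pt a w) = \<beta> a w"
    using tensor_universal[OF U, of \<beta>] closed add_left add_right balanced smult by blast
  show thesis
    by (rule that[of L]) (use L in \<open>simp_all add: ind_space_eq t_def ind_tensor_eq delta_GA \<beta>_delta\<close>)
qed

text \<open>The tensors \<open>t x b\<close> with \<open>b\<close> in a finite spanning set of
  \<open>W\<close> span \<open>V\<close>: for fixed \<open>x\<close>, the \<open>w\<close> with
  \<open>t x w\<close> in a given subspace form a subspace of \<open>W\<close>.\<close>

lemma fd_V: "fd_space V"
proof -
  obtain B where B: "finite B" "B \<subseteq> carrier W"
    and span: "\<And>N. subspace class_ring N W \<Longrightarrow> B \<subseteq> N \<Longrightarrow> N = carrier W"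
    using rep fd_spaceE[of W] by (auto simp: group_rep_def)
  show ?thesis
  proof (rule fd_spaceI[OF V])
    show "finite ((\<lambda>(x, w). t x w) ` (carrier G \<times> B))" using finite_G B by auto
    show "(\<lambda>(x, w). t x w) ` (carrier G \<times> B) \<subseteq> carrier V" using B by (auto intro!: t_closed)
    fix N assume N: "subspace class_ring N V" "(\<lambda>(x, w). t x w) ` (carrier G \<times> B) \<subseteq> N"
    have "t x w \<in> N" if "x \<in> carrier G" "w \<in> carrier W" for x w
    proof -
      have "{w \<in> carrier W. t x w \<in> N} = carrier W"
        by (rule span[OF subspace_vimage[OF lin_map_t N(1)]]) (use that N(2) B in auto)
      then show ?thesis using that by blast
    qed
    note t_N = this
    have "v \<in> N" if "v \<in> carrier V" for v
      using that by (induction rule: ind_induct) (auto intro: t_N subspaceD(4)[OF N(1)])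
    then show "carrier V \<subseteq> N" by blast
  qed
qed

text \<open>Left translation commutes with right translation by \<open>K\<close>, so
  \<open>ind_universal\<close> supplies a map \<open>L\<close> with the desired values on the
  \<open>t x w\<close>. The definition of \<open>ind_action\<close> prescribes values on all pure
  tensors; \<open>L_pt\<close> verifies these before \<open>L\<close> is identified with the
  action.\<close>

lemma ind_action_props:
  assumes g: "g \<in> carrier G"
  shows "lin_map V V (ind_action G K W \<sigma> g)"
    and "x \<in> carrier G \<Longrightarrow> w \<in> carrier W \<Longrightarrow> ind_action G K W \<sigma> g (t x w) = t (g \<otimes> x) w"
proof -
  obtain L where L: "lin_map V V L"
    "\<And>x w. x \<in> carrier G \<Longrightarrow> w \<in> carrier W \<Longrightarrow> L (t x w) = t (g \<otimes> x) w"
    using ind_universal[of V "\<lambda>x. t (g \<otimes> x)"] g K_subset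
    by (auto simp: lin_map_t t_translate simp flip: m_assoc)
  have L_pt: "L (pt a w) = pt (delta g \<otimes>\<^bsub>GA\<^esub> a) w" if "a \<in> carrier GA" and w: "w \<in> carrier W" for a w
    using that(1)
  proof (induction rule: GA_induct)
    case (delta c x)
    have "L (pt (delta x) w) = pt (delta (g \<otimes> x)) w"
      using L(2)[OF delta w] by (simp add: t_def ind_tensor_eq)
    then show ?case
      using g w delta lin_mapD[OF L(1)]
      by (simp add: pt_smult delta_GA conv_smult_right conv_delta pt_closed ind_space_eq)
  next
    case (add a b)
    then show ?case
      using g w lin_mapD[OF L(1)]
      by (simp add: pt_add_left conv_add_right conv_closed pt_closed ind_space_eq)
  qed
  have eq: "ind_action G K W \<sigma> g = restrict L (carrier V)"
    unfolding ind_action_def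
  proof (rule linear_extension_eqI[OF L(1)])
    fix S v assume S: "lin_map V V S" and v: "v \<in> carrier V"
      and "\<And>i. i \<in> carrier GA \<times> carrier W \<Longrightarrow>
        S (case i of (a, w) \<Rightarrow> ind_tensor G K W \<sigma> a w) = L (case i of (a, w) \<Rightarrow> ind_tensor G K W \<sigma> a w)"
    from this(3)[of "(delta _, _)"] show "S v = L v"
      by (intro lin_map_eqI[OF S L(1) _ v]) (simp add: t_def delta_GA)
  qed (auto simp: ind_tensor_eq ind_space_eq pt_closed L_pt)
  show "lin_map V V (ind_action G K W \<sigma> g)"
    unfolding eq by (rule lin_map_restrict[OF L(1)])
  show "x \<in> carrier G \<Longrightarrow> w \<in> carrier W \<Longrightarrow> ind_action G K W \<sigma> g (t x w) = t (g \<otimes> x) w"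
    unfolding eq using L(2) t_closed by simp
qed

end

section \<open>Projections onto unions of cosets\<close>

lemma (in group) subgroup_left_stabilizer:
  assumes "A \<subseteq> carrier G"
  shows "subgroup (left_stabilizer G A) G"
proof (rule subgroupI)
  show "left_stabilizer G A \<noteq> {}"
    using lcos_mult_one[OF assms] by (auto simp: left_stabilizer_def)
  fix g assume g: "g \<in> left_stabilizer G A"
  then have g': "g \<in> carrier G" "g <# A = A" by (simp_all add: left_stabilizer_def)
  have "inv g <# (g <# A) = A" using g'(1) assms by (simp add: lcos_m_assoc lcos_mult_one)
  then show "inv g \<in> left_stabilizer G A" using g' by (simp add: left_stabilizer_def)
  fix h assume h: "h \<in> left_stabilizer G A"
  then show "g \<otimes> h \<in> left_stabilizer G A"
    using g assms by (simp add: left_stabilizer_def flip: lcos_m_assoc)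
qed (auto simp: left_stabilizer_def)

lemma finsum_in_subspace:
  fixes V :: "(complex, 'v) module"
  assumes "subspace class_ring N V" "\<And>i. i \<in> I \<Longrightarrow> u i \<in> N"
  shows "(\<Oplus>\<^bsub>V\<^esub>i\<in>I. u i) \<in> N"
proof -
  note ND = subspaceD[OF assms(1)]
  interpret V: vectorspace class_ring V by (rule ND)
  show ?thesis
    using assms(2)
  proof (induction I rule: infinite_finite_induct)
    case (insert i I)
    then have "u \<in> I \<rightarrow> carrier V" "u i \<in> carrier V" using ND(2) by auto
    then show ?case using insert by (simp add: ND(4))
  qed (use ND in auto)
qed

context induction_data
begin

abbreviation \<rho> where "\<rho> \<equiv> ind_action G K W \<sigma>"

lemmas \<rho>_lin = ind_action_props(1) and \<rho>_t = ind_action_props(2)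

lemmas \<rho>_closed = lin_mapD(3)[OF \<rho>_lin]

lemma group_rep_ind: "group_rep G V \<rho>"
  unfolding group_rep_def
proof (intro conjI ballI fd_V \<rho>_lin)
  have id: "lin_map V V (\<lambda>v. v)" by (rule lin_mapI[OF V V]) simp_all
  show "\<rho> \<one> v = v" if "v \<in> carrier V" for v
    by (rule lin_map_eqI[OF \<rho>_lin id _ that]) (simp_all add: \<rho>_t)
  show "\<rho> (g \<otimes> h) v = \<rho> g (\<rho> h v)"
    if "g \<in> carrier G" "h \<in> carrier G" "v \<in> carrier V" for g h v
    by (rule lin_map_eqI[OF \<rho>_lin lin_map_comp[OF \<rho>_lin \<rho>_lin]]) (simp_all add: that \<rho>_t m_assoc)
qed

text \<open>The part of \<open>Z\<close> inside \<open>G\<close> is a union of left cosets of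
  \<open>K\<close>. Only elements of \<open>G\<close> are tested, so \<open>Z\<close> may be a
  complement or a preimage taken in the whole type.\<close>

definition right_stable :: "'g set \<Rightarrow> bool" where
  "right_stable Z \<longleftrightarrow> (\<forall>x\<in>carrier G. \<forall>k\<in>K. x \<otimes> k \<in> Z \<longleftrightarrow> x \<in> Z)"

text \<open>The projection onto the components of the cosets in \<open>Z\<close>, along the
  remaining components. It is meaningful for right stable \<open>Z\<close>, where membership depends
  only on the coset and \<open>ind_universal\<close> provides the map.\<close>

definition proj :: "'g set \<Rightarrow> ('g, 'w) ind_vec \<Rightarrow> ('g, 'w) ind_vec" where
  "proj Z = (SOME L. lin_map V V L \<and>
     (\<forall>x\<in>carrier G. \<forall>w\<in>carrier W. L (t x w) = (if x \<in> Z then t x w else \<zero>\<^bsub>V\<^esub>)))"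

lemma lin_map_zero: "lin_map W V (\<lambda>_. \<zero>\<^bsub>V\<^esub>)"
  by (rule lin_mapI[OF W V]) (simp_all add: VD)

lemma proj_props:
  assumes "right_stable Z"
  shows "lin_map V V (proj Z)"
    and "x \<in> carrier G \<Longrightarrow> w \<in> carrier W \<Longrightarrow> proj Z (t x w) = (if x \<in> Z then t x w else \<zero>\<^bsub>V\<^esub>)"
proof -
  have "\<exists>L. lin_map V V L \<and>
     (\<forall>x\<in>carrier G. \<forall>w\<in>carrier W. L (t x w) = (if x \<in> Z then t x w else \<zero>\<^bsub>V\<^esub>))"
    by (rule ind_universal[of V "\<lambda>x. if x \<in> Z then t x else (\<lambda>_. \<zero>\<^bsub>V\<^esub>)"])
      (use assms K_subset in \<open>auto simp: right_stable_def lin_map_t lin_map_zero t_translate\<close>)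
  from someI_ex[OF this] show "lin_map V V (proj Z)"
    "x \<in> carrier G \<Longrightarrow> w \<in> carrier W \<Longrightarrow> proj Z (t x w) = (if x \<in> Z then t x w else \<zero>\<^bsub>V\<^esub>)"
    by (simp_all add: proj_def)
qed

lemmas proj_lin = proj_props(1) and proj_t = proj_props(2)

lemma right_stable_UNIV: "right_stable UNIV"
  and right_stable_Int: "right_stable Y \<Longrightarrow> right_stable Z \<Longrightarrow> right_stable (Y \<inter> Z)"
  and right_stable_Un: "right_stable Y \<Longrightarrow> right_stable Z \<Longrightarrow> right_stable (Y \<union> Z)"
  and right_stable_Compl: "right_stable Z \<Longrightarrow> right_stable (- Z)"
  by (auto simp: right_stable_def)

lemma right_stable_Union: "(\<And>Z. Z \<in> ZZ \<Longrightarrow> right_stable Z) \<Longrightarrow> right_stable (\<Union>ZZ)"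
  by (auto simp: right_stable_def)

lemma right_stable_vimage:
  assumes "g \<in> carrier G" "right_stable Z"
  shows "right_stable {x. g \<otimes> x \<in> Z}"
  using assms K_subset by (auto simp: right_stable_def simp flip: m_assoc)

lemma right_stable_coset:
  assumes "a \<in> carrier G"
  shows "right_stable (a <# K)"
  unfolding right_stable_def
proof (intro ballI)
  have *: "y \<in> a <# K \<longleftrightarrow> inv a \<otimes> y \<in> K" if "y \<in> carrier G" for y
    using subgroup.lcos_module_rev[OF K is_group assms that]
      subgroup.lcos_module_imp[OF K is_group assms, of y] by blast
  fix x k assume xk: "x \<in> carrier G" "k \<in> K"
  have "inv a \<otimes> (x \<otimes> k) \<in> K \<longleftrightarrow> inv a \<otimes> x \<in> K"
  proof
    assume "inv a \<otimes> (x \<otimes> k) \<in> K"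
    then have "inv a \<otimes> (x \<otimes> k) \<otimes> inv k \<in> K"
      using xk K by (simp add: subgroup.m_closed subgroup.m_inv_closed)
    then show "inv a \<otimes> x \<in> K" using assms xk K_subset by (simp add: m_assoc)
  qed (use assms xk K K_subset in \<open>simp add: subgroup.m_closed flip: m_assoc\<close>)
  then show "x \<otimes> k \<in> a <# K \<longleftrightarrow> x \<in> a <# K" using * xk K_subset by simp
qed

lemma proj_proj:
  assumes "right_stable Y" "right_stable Z" "v \<in> carrier V"
  shows "proj Y (proj Z v) = proj (Y \<inter> Z) v"
  by (rule lin_map_eqI[OF lin_map_comp[OF proj_lin proj_lin] proj_lin])
    (use assms in \<open>auto simp: right_stable_Int proj_t lin_mapD(6)[OF proj_lin]\<close>)

text \<open>Overlapping sets are allowed on purpose. With \<open>Z = UNIV\<close> this decomposes a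
  vector into complementary parts; with \<open>Y\<close> a coset it is the induction step of
  \<open>zero_if_components_zero\<close>.\<close>

lemma proj_split:
  assumes "right_stable Y" "right_stable Z" "v \<in> carrier V"
  shows "proj (Y \<union> Z) v = proj Y v \<oplus>\<^bsub>V\<^esub> proj (- Y) (proj Z v)"
  using assms(3)
proof (induction rule: ind_induct)
  case (tensor x w)
  then show ?case
    using assms by (auto simp: proj_t right_stable_Un right_stable_Compl t_closed VD lin_mapD(6)[OF proj_lin])
next
  case (add u v)
  interpret V: vectorspace class_ring V by (rule V)
  show ?case
    using add assms
    by (simp add: right_stable_Un right_stable_Compl lin_mapD(3,4)[OF proj_lin] V.add.m_ac)
qed

lemma proj_eqI:
  assumes "right_stable Y" "right_stable Z" "v \<in> carrier V"
    and "\<And>x. x \<in> carrier G \<Longrightarrow> x \<in> Y \<longleftrightarrow> x \<in> Z"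
  shows "proj Y v = proj Z v"
  by (rule lin_map_eqI[OF proj_lin proj_lin]) (use assms in \<open>auto simp: proj_t\<close>)

lemma proj_all:
  assumes "right_stable Z" "carrier G \<subseteq> Z" "v \<in> carrier V"
  shows "proj Z v = v"
  by (rule lin_map_eqI[OF proj_lin lin_mapI[OF V V]]) (use assms in \<open>auto simp: proj_t\<close>)

lemma proj_none:
  assumes "right_stable Z" "carrier G \<inter> Z = {}" "v \<in> carrier V"
  shows "proj Z v = \<zero>\<^bsub>V\<^esub>"
  by (rule lin_map_eqI[OF proj_lin lin_mapI[OF V V]]) (use assms in \<open>auto simp: proj_t VD\<close>)

text \<open>A tensor over \<open>x = a \<otimes> k\<close> can be rewritten over the fixed
  representative \<open>a\<close> by moving \<open>k\<close> to \<open>w\<close>, and sums over the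
  same representative combine into one tensor.\<close>

lemma proj_coset:
  assumes "a \<in> carrier G" "v \<in> carrier V"
  shows "\<exists>w\<in>carrier W. proj (a <# K) v = t a w"
  using assms(2)
proof (induction rule: ind_induct)
  case (tensor x w)
  note rs = right_stable_coset[OF assms(1)]
  show ?case
  proof (cases "x \<in> a <# K")
    case True
    then obtain k where "k \<in> K" "x = a \<otimes> k" by (auto simp: l_coset_def)
    then show ?thesis
      using True tensor assms(1) by (auto simp: proj_t[OF rs] t_translate \<sigma>_closed lcos_self[OF _ K])
  next
    case False
    then show ?thesis
      using tensor assms(1) t_zero WD(1) by (auto simp: proj_t[OF rs] intro!: bexI[of _ "\<zero>\<^bsub>W\<^esub>"])
  qed
next
  case (add u v)
  then show ?case
    using assms(1) by (auto simp: lin_mapD(4)[OF proj_lin[OF right_stable_coset]] WD simp flip: t_add)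
qed

lemma lcosetE:
  assumes "C \<in> lcosets K"
  obtains a where "a \<in> carrier G" "C = a <# K"
  using assms by (auto simp: LCOSETS_def)

lemma coset_part_eq:
  assumes a: "a \<in> carrier G"
  shows "coset_part G K W \<sigma> (a <# K) = t a ` carrier W"
proof (rule equalityI; rule subsetI)
  fix v assume "v \<in> coset_part G K W \<sigma> (a <# K)"
  then obtain k w where "k \<in> K" "w \<in> carrier W" "v = t (a \<otimes> k) w"
    by (auto simp: coset_part_def l_coset_def t_def)
  then show "v \<in> t a ` carrier W" using a by (simp add: t_translate \<sigma>_closed)
next
  fix v assume "v \<in> t a ` carrier W"
  then show "v \<in> coset_part G K W \<sigma> (a <# K)"
    using lcos_self[OF a K] unfolding coset_part_def t_def by auto
qed

lemma fixed_subspace: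
  assumes "right_stable Z"
  shows "subspace class_ring {v \<in> carrier V. proj Z v = v} V"
  by (rule subspaceI[OF V]) (auto simp: lin_mapD[OF proj_lin[OF assms]] VD)

text \<open>Tensors over elements of the cosets in \<open>CC\<close> are fixed by the projection,
  and the fixed vectors form a subspace. Conversely, \<open>image\<close> shows by induction that
  the projection of any vector is such a sum: a tensor gives a family concentrated in one coset, and
  families are added coset by coset.\<close>

lemma coset_parts_sum_eq:
  assumes CC: "CC \<subseteq> lcosets K"
  shows "coset_parts_sum G K W \<sigma> CC = {v \<in> carrier V. proj (\<Union>CC) v = v}"
proof (rule equalityI; rule subsetI)
  interpret V: vectorspace class_ring V by (rule V)
  have rs: "right_stable (\<Union>CC)"
    using CC by (intro right_stable_Union) (auto elim!: lcosetE intro: right_stable_coset)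
  have part: "\<exists>a\<in>carrier G. C = a <# K \<and> coset_part G K W \<sigma> C = t a ` carrier W" if "C \<in> CC" for C
    using that CC coset_part_eq by (blast elim: lcosetE)
  have part_closed: "u \<in> CC \<rightarrow> carrier V" if u: "\<forall>C\<in>CC. u C \<in> coset_part G K W \<sigma> C" for u
  proof
    fix C assume "C \<in> CC"
    then obtain a where "a \<in> carrier G" "u C \<in> t a ` carrier W" using part[of C] u by metis
    then show "u C \<in> carrier V" using t_closed by auto
  qed
  {
    fix v assume "v \<in> coset_parts_sum G K W \<sigma> CC"
    then obtain u where u: "\<forall>C\<in>CC. u C \<in> coset_part G K W \<sigma> C" "v = (\<Oplus>\<^bsub>V\<^esub>C\<in>CC. u C)"
      unfolding coset_parts_sum_def by blast
    have "u C \<in> {v \<in> carrier V. proj (\<Union>CC) v = v}" if C: "C \<in> CC" for C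
    proof -
      obtain a w where a: "a \<in> carrier G" "C = a <# K" "w \<in> carrier W" "u C = t a w"
        using part[OF C] u(1) C by blast
      then have "a \<in> \<Union>CC" using lcos_self[OF a(1) K] C by blast
      then show ?thesis using a by (simp add: t_closed proj_t[OF rs])
    qed
    then show "v \<in> {v \<in> carrier V. proj (\<Union>CC) v = v}"
      unfolding u(2) by (rule finsum_in_subspace[OF fixed_subspace[OF rs]])
  }
  have zero_part: "\<zero>\<^bsub>V\<^esub> \<in> coset_part G K W \<sigma> C" if C: "C \<in> CC" for C
  proof -
    obtain a where "a \<in> carrier G" "coset_part G K W \<sigma> C = t a ` carrier W" using part[OF C] by blast
    then show ?thesis using t_zero[of a] WD(1) by (metis image_eqI)
  qed
  have finite_CC: "finite CC"
    using CC finite_G by (auto simp: LCOSETS_def intro: finite_subset)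
  have image: "proj (\<Union>CC) v \<in> coset_parts_sum G K W \<sigma> CC" if "v \<in> carrier V" for v
    using that
  proof (induction rule: ind_induct)
    case (tensor x w)
    show ?case
    proof (cases "x \<in> \<Union>CC")
      case True
      then obtain C where C: "C \<in> CC" "x \<in> C" by blast
      define u where "u D = (if C = D then t x w else \<zero>\<^bsub>V\<^esub>)" for D
      have "t x w \<in> coset_part G K W \<sigma> C"
        using C tensor unfolding coset_part_def t_def by blast
      then have "\<forall>D\<in>CC. u D \<in> coset_part G K W \<sigma> D" by (auto simp: u_def zero_part)
      moreover have "(\<Oplus>\<^bsub>V\<^esub>D\<in>CC. u D) = t x w"
        unfolding u_def using C tensor finite_CC
        by (intro V.finsum_singleton) (auto simp: t_closed)
      ultimately show ?thesis
        using True tensor unfolding coset_parts_sum_def by (auto simp: proj_t[OF rs])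
    next
      case False
      have "(\<Oplus>\<^bsub>V\<^esub>D\<in>CC. \<zero>\<^bsub>V\<^esub>) = \<zero>\<^bsub>V\<^esub>" by simp
      then have "\<zero>\<^bsub>V\<^esub> \<in> coset_parts_sum G K W \<sigma> CC"
        unfolding coset_parts_sum_def using zero_part by force
      then show ?thesis using False tensor by (simp add: proj_t[OF rs])
    qed
  next
    case (add v v')
    then obtain u u' where u: "\<forall>C\<in>CC. u C \<in> coset_part G K W \<sigma> C" "proj (\<Union>CC) v = (\<Oplus>\<^bsub>V\<^esub>C\<in>CC. u C)"
      and u': "\<forall>C\<in>CC. u' C \<in> coset_part G K W \<sigma> C" "proj (\<Union>CC) v' = (\<Oplus>\<^bsub>V\<^esub>C\<in>CC. u' C)"
      unfolding coset_parts_sum_def by blast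
    have "proj (\<Union>CC) (v \<oplus>\<^bsub>V\<^esub> v') = (\<Oplus>\<^bsub>V\<^esub>C\<in>CC. u C \<oplus>\<^bsub>V\<^esub> u' C)"
      using add u u' by (simp add: lin_mapD(4)[OF proj_lin[OF rs]] V.finsum_addf part_closed)
    \<comment> \<open>A coset part is closed under addition because both vectors can be written over
      the same representative \<open>a\<close>.\<close>
    moreover have "u C \<oplus>\<^bsub>V\<^esub> u' C \<in> coset_part G K W \<sigma> C" if C: "C \<in> CC" for C
    proof -
      obtain a where a: "a \<in> carrier G" "coset_part G K W \<sigma> C = t a ` carrier W"
        using part[OF C] by blast
      have "u C \<in> t a ` carrier W" using u(1) C a(2) by auto
      then obtain w where w: "w \<in> carrier W" "u C = t a w" by (rule imageE) (rule that)
      have "u' C \<in> t a ` carrier W" using u'(1) C a(2) by auto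
      then obtain w' where w': "w' \<in> carrier W" "u' C = t a w'" by (rule imageE) (rule that)
      have "u C \<oplus>\<^bsub>V\<^esub> u' C = t a (w \<oplus>\<^bsub>W\<^esub> w')" "w \<oplus>\<^bsub>W\<^esub> w' \<in> carrier W"
        using a w w' WD(2) by (simp_all add: t_add)
      then show ?thesis unfolding a(2) by blast
    qed
    ultimately show ?case unfolding coset_parts_sum_def by auto
  qed
  fix v assume "v \<in> {v \<in> carrier V. proj (\<Union>CC) v = v}"
  then show "v \<in> coset_parts_sum G K W \<sigma> CC" using image[of v] by simp
qed

text \<open>The tensor product does not collapse: the rule \<open>t x w\<close> \<mapsto>
  \<open>\<sigma> x w\<close> for \<open>x\<close> in \<open>K\<close>, and zero for other
  \<open>x\<close>, respects translation by \<open>K\<close> and recovers \<open>w\<close> from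
  \<open>t \<one> w\<close>.\<close>

lemma t_one_nonzero:
  assumes "w \<in> carrier W" "w \<noteq> \<zero>\<^bsub>W\<^esub>"
  shows "t \<one> w \<noteq> \<zero>\<^bsub>V\<^esub>"
proof -
  have K_iff: "x \<otimes> k \<in> K \<longleftrightarrow> x \<in> K" if "x \<in> carrier G" "k \<in> K" for x k
    using right_stable_coset[OF one_closed] that lcos_mult_one[OF subgroup.subset[OF K]]
    by (simp add: right_stable_def)
  have zero: "lin_map W W (\<lambda>_. \<zero>\<^bsub>W\<^esub>)"
    by (rule lin_mapI[OF W W]) (simp_all add: WD)
  obtain L where L: "lin_map V W L"
    "\<And>x w. x \<in> carrier G \<Longrightarrow> w \<in> carrier W \<Longrightarrow> L (t x w) = (if x \<in> K then \<sigma> x else (\<lambda>_. \<zero>\<^bsub>W\<^esub>)) w"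
    by (rule ind_universal[of W "\<lambda>x. if x \<in> K then \<sigma> x else (\<lambda>_. \<zero>\<^bsub>W\<^esub>)"])
      (auto simp: \<sigma>_lin zero K_iff \<sigma>_mult)
  have "L (t \<one> w) = w" using L(2)[of \<one> w] assms subgroup.one_closed[OF K] by (simp add: \<sigma>_one)
  then show ?thesis using lin_mapD(6)[OF L(1)] assms by auto
qed

end

section \<open>The partial representation induced from a union of cosets\<close>

lemma (in group) coset_unions_subset:
  assumes "subgroup H G" "A \<in> coset_unions G H"
  shows "A \<subseteq> carrier G"
proof -
  have "C \<subseteq> carrier G" if "C \<in> lcosets H" for C
    using that l_coset_subset_G[OF subgroup.subset[OF assms(1)]] by (auto simp: LCOSETS_def)
  then show ?thesis using assms(2) by (auto simp: coset_unions_def)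
qed

locale coset_union_data = induction_data G K W \<sigma>
  for G :: "('g, 'm) monoid_scheme" (structure) and K and W :: "(complex, 'w) module" and \<sigma> +
  fixes H A :: "'g set"
  assumes H: "subgroup H G" and A: "A \<in> coset_unions G H" and K_eq: "K = left_stabilizer G A"
begin

text \<open>Inversion swaps sides. \<open>A\<close> is stable under \<open>H\<close> on the right
  and under \<open>K\<close> on the left, hence \<open>B\<close> is stable under \<open>H\<close> on
  the left and under \<open>K\<close> on the right. The first makes the action global on
  \<open>H\<close>; the second makes the projection onto \<open>B\<close> well defined.\<close>

definition B :: "'g set" where "B = set_inv A"

abbreviation P where "P \<equiv> pind_space G A W \<sigma>"
abbreviation pr where "pr \<equiv> proj B"
abbreviation \<pi> where "\<pi> \<equiv> pind_action G A W \<sigma>"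

section \<open>Stability properties of \<open>A\<close> and of its inverse set
  \<open>B\<close>\<close>

lemma A_subset: "A \<subseteq> carrier G"
  using coset_unions_subset[OF H A] .

lemma A_H:
  assumes "a \<in> A" "h \<in> H"
  shows "a \<otimes> h \<in> A"
proof -
  obtain CC where CC: "CC \<subseteq> lcosets H" "A = \<Union>CC" using A by (auto simp: coset_unions_def)
  then obtain C g where C: "a \<in> C" "C \<in> CC" "g \<in> carrier G" "C = g <# H"
    using assms by (auto simp: LCOSETS_def)
  then obtain h' where "h' \<in> H" "a = g \<otimes> h'" by (auto simp: l_coset_def)
  moreover have "g \<otimes> h' \<otimes> h = g \<otimes> (h' \<otimes> h)" "h' \<otimes> h \<in> H"
    using C(3) \<open>h' \<in> H\<close> assms(2) subgroup.subset[OF H] subgroup.m_closed[OF H]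
    by (auto intro!: m_assoc)
  ultimately have "a \<otimes> h \<in> C" using C(4) by (auto simp: l_coset_def)
  then show ?thesis using C CC by auto
qed

lemma K_A:
  assumes "k \<in> K" "a \<in> A"
  shows "k \<otimes> a \<in> A"
  using assms unfolding K_eq left_stabilizer_def by (auto simp: l_coset_def)

lemma B_iff: "x \<in> carrier G \<Longrightarrow> x \<in> B \<longleftrightarrow> inv x \<in> A"
  using A_subset by (force simp: B_def SET_INV_def)

lemma B_subset: "B \<subseteq> carrier G"
  using A_subset by (auto simp: B_def SET_INV_def)

lemma one_B: "\<one> \<in> B"
  using A subgroup.one_closed[OF H] by (auto simp: B_iff coset_unions_def)

lemma H_B:
  assumes "h \<in> H" "x \<in> carrier G"
  shows "h \<otimes> x \<in> B \<longleftrightarrow> x \<in> B"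
proof -
  have h: "h \<in> carrier G" "inv h \<in> H"
    using assms H by (auto simp: subgroup.mem_carrier subgroup.m_inv_closed)
  have "h \<otimes> x \<in> B" if "h \<in> H" "x \<in> B" "x \<in> carrier G" for h x
    using that A_H[of "inv x" "inv h"] H
    by (simp add: B_iff inv_mult_group subgroup.mem_carrier subgroup.m_inv_closed)
  from this[of h x] this[of "inv h" "h \<otimes> x"] show ?thesis
    using assms h by (auto simp flip: m_assoc)
qed

lemma right_stable_B: "right_stable B"
  unfolding right_stable_def
proof (intro ballI)
  fix x k assume xk: "x \<in> carrier G" "k \<in> K"
  have k: "k \<in> carrier G" "inv k \<in> K"
    using xk K by (auto simp: subgroup.mem_carrier subgroup.m_inv_closed)
  have "y \<otimes> l \<in> B" if "l \<in> K" "y \<in> B" "y \<in> carrier G" for l y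
    using that K_A[of "inv l" "inv y"] K
    by (simp add: B_iff inv_mult_group subgroup.mem_carrier subgroup.m_inv_closed)
  from this[of k x] this[of "inv k" "x \<otimes> k"] show "x \<otimes> k \<in> B \<longleftrightarrow> x \<in> B"
    using xk k by (auto simp: m_assoc)
qed

lemma K_B: "k \<in> K \<Longrightarrow> k \<in> B"
  using right_stable_B one_B K_subset[of k] unfolding right_stable_def by (metis l_one one_closed)

text \<open>As \<open>A\<close> is finite, an inclusion \<open>gA \<subseteq> A\<close> is already an equality.\<close>

lemma stabilizer_of_translates:
  assumes xy: "x \<in> carrier G" "y \<in> carrier G" and "\<And>b. b \<in> B \<Longrightarrow> b \<otimes> inv x \<otimes> y \<in> B"
  shows "inv x \<otimes> y \<in> K"
proof -
  \<comment> \<open>Inverting \<open>b \<otimes> inv x \<otimes> y\<close> with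
    \<open>b = inv a\<close> gives \<open>g \<otimes> a\<close>, so the hypothesis on
    \<open>B\<close> becomes \<open>g <# A \<subseteq> A\<close>.\<close>
  define g where "g = inv y \<otimes> x"
  have g: "g \<in> carrier G" using xy by (simp add: g_def)
  have "g \<otimes> a \<in> A" if a: "a \<in> A" for a
  proof -
    have a': "a \<in> carrier G" using a A_subset by auto
    then have "inv a \<otimes> inv x \<otimes> y \<in> B" using a assms(3) by (simp add: B_iff)
    then show ?thesis using a' xy by (simp add: B_iff g_def inv_mult_group m_assoc)
  qed
  then have sub: "g <# A \<subseteq> A" by (auto simp: l_coset_def)
  have "finite A" using A_subset finite_G finite_subset by blast
  moreover have "card (g <# A) = card A"
  proof -
    have "g <# A = (\<lambda>a. g \<otimes> a) ` A" by (auto simp: l_coset_def)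
    moreover have "inj_on (\<lambda>a. g \<otimes> a) A" using inj_on_subset[OF inj_on_cmult[OF g] A_subset] .
    ultimately show ?thesis by (simp add: card_image)
  qed
  ultimately have "g <# A = A" using sub by (intro card_subset_eq)
  then have "inv g \<in> K"
    using g subgroup.m_inv_closed[OF K] by (simp add: K_eq left_stabilizer_def)
  then show ?thesis using xy by (simp add: g_def inv_mult_group)
qed

text \<open>Translates between families of cosets, as in the definitions, and the sets that index
  \<open>proj\<close>.\<close>

lemma Union_cosets:
  assumes "right_stable Z"
  shows "\<Union>{C \<in> lcosets K. C \<subseteq> Z} = Z \<inter> carrier G"
proof (rule equalityI; rule subsetI)
  fix x assume "x \<in> \<Union>{C \<in> lcosets K. C \<subseteq> Z}"
  then show "x \<in> Z \<inter> carrier G"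
    using l_coset_subset_G[OF subgroup.subset[OF K]] by (auto elim!: lcosetE)
next
  fix x assume x: "x \<in> Z \<inter> carrier G"
  then have "x <# K \<subseteq> Z" using assms by (auto simp: right_stable_def l_coset_def)
  moreover have "x <# K \<in> lcosets K" "x \<in> x <# K"
    using x lcos_self K by (auto simp: LCOSETS_def)
  ultimately show "x \<in> \<Union>{C \<in> lcosets K. C \<subseteq> Z}" by blast
qed

text \<open>Right stability leaves only two possibilities, inside \<open>B\<close> or disjoint from
  it. Hence the complement used to define the projection consists of the components in
  \<open>- B\<close>.\<close>

lemma coset_not_subset_iff:
  assumes "C \<in> lcosets K"
  shows "\<not> C \<subseteq> B \<longleftrightarrow> C \<subseteq> - B"
proof -
  obtain a where a: "a \<in> carrier G" "C = a <# K" using assms by (rule lcosetE)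
  then have "x \<in> B \<longleftrightarrow> a \<in> B" if "x \<in> C" for x
    using that right_stable_B by (auto simp: right_stable_def l_coset_def)
  moreover have "a \<in> C" using a lcos_self K by simp
  ultimately show ?thesis by blast
qed

section \<open>The space \<open>P\<close> and the compressed action on it\<close>

lemma proj_empty: "v \<in> carrier V \<Longrightarrow> proj {} v = \<zero>\<^bsub>V\<^esub>"
  by (rule proj_none) (simp_all add: right_stable_def)

lemmas pr_lin = proj_lin[OF right_stable_B]
lemmas pr_t = proj_t[OF right_stable_B]
lemmas pr_closed = lin_mapD(3)[OF pr_lin]
lemma carrier_P: "carrier P = {v \<in> carrier V. pr v = v}"
proof -
  have "carrier P = coset_parts_sum G K W \<sigma> {C \<in> lcosets K. C \<subseteq> B}"
    by (simp add: pind_space_def Let_def B_def K_eq)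
  also have "\<dots> = {v \<in> carrier V. proj (\<Union>{C \<in> lcosets K. C \<subseteq> B}) v = v}"
    by (rule coset_parts_sum_eq) blast
  also have "\<dots> = {v \<in> carrier V. pr v = v}"
    unfolding Union_cosets[OF right_stable_B] Int_absorb2[OF B_subset] ..
  finally show ?thesis .
qed

lemma complement_sum:
  "coset_parts_sum G K W \<sigma> {C \<in> lcosets K. \<not> C \<subseteq> B} = {v \<in> carrier V. proj (- B) v = v}"
proof -
  have eq: "{C \<in> lcosets K. \<not> C \<subseteq> B} = {C \<in> lcosets K. C \<subseteq> - B}"
    using coset_not_subset_iff by auto
  have rs: "right_stable (- B)" by (rule right_stable_Compl[OF right_stable_B])
  have "right_stable (\<Union>{C \<in> lcosets K. C \<subseteq> - B})"
    by (rule right_stable_Union) (auto elim!: lcosetE intro: right_stable_coset)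
  then have "proj (\<Union>{C \<in> lcosets K. C \<subseteq> - B}) v = proj (- B) v" if "v \<in> carrier V" for v
    using rs that by (intro proj_eqI) (auto simp: Union_cosets[OF rs])
  moreover have "coset_parts_sum G K W \<sigma> {C \<in> lcosets K. C \<subseteq> - B} =
      {v \<in> carrier V. proj (\<Union>{C \<in> lcosets K. C \<subseteq> - B}) v = v}"
    by (rule coset_parts_sum_eq) blast
  ultimately show ?thesis unfolding eq by auto
qed

lemma P_simps: "add P = add V" "smult P = smult V" "zero P = zero V"
  by (simp_all add: pind_space_def Let_def flip: K_eq)

lemma P_eq: "P = V\<lparr>carrier := {v \<in> carrier V. pr v = v}\<rparr>"
  unfolding carrier_P[symmetric] by (simp add: pind_space_def Let_def flip: K_eq)

lemma P_vs: "vectorspace class_ring P"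
  unfolding P_eq by (rule vectorspace_subspace[OF fixed_subspace[OF right_stable_B]])

lemma P_closed: "v \<in> carrier P \<Longrightarrow> v \<in> carrier V"
  and P_fixed: "v \<in> carrier P \<Longrightarrow> pr v = v"
  by (simp_all add: carrier_P)

lemma pr_pr: "v \<in> carrier V \<Longrightarrow> pr (pr v) = pr v"
  by (simp add: proj_proj right_stable_B)

lemma pr_P: "lin_map V P pr"
  by (rule lin_mapI[OF V P_vs])
    (simp_all add: carrier_P P_simps pr_closed pr_pr lin_mapD(4,5)[OF pr_lin])

lemma incl_P: "lin_map P V (\<lambda>v. v)"
  by (rule lin_mapI[OF P_vs V]) (simp_all add: P_simps P_closed)

lemma t_P: "x \<in> B \<Longrightarrow> w \<in> carrier W \<Longrightarrow> t x w \<in> carrier P"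
  using B_subset by (auto simp: carrier_P t_closed pr_t)

lemma lin_map_t_P: "x \<in> B \<Longrightarrow> lin_map W P (t x)"
  using B_subset by (intro lin_mapI[OF W P_vs]) (auto simp: P_simps t_P t_add t_smult)

lemma fd_P: "fd_space P"
proof (rule fd_space_image[OF pr_P _ fd_V])
  show "pr ` carrier V = carrier P"
    by (auto simp: carrier_P pr_closed pr_pr intro: rev_image_eqI)
qed

text \<open>Composing with \<open>pr\<close> extends both maps to \<open>V\<close>. There they agree
  on tensors over \<open>B\<close> by hypothesis and vanish on all other tensors, so the criterion
  for \<open>V\<close> applies.\<close>

lemma P_eqI:
  assumes S: "lin_map P U S" and S': "lin_map P U S'"
    and t: "\<And>x w. x \<in> B \<Longrightarrow> w \<in> carrier W \<Longrightarrow> S (t x w) = S' (t x w)"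
    and v: "v \<in> carrier P"
  shows "S v = S' v"
proof -
  have "S (pr v) = S' (pr v)"
  proof (rule lin_map_eqI[OF lin_map_comp[OF pr_P S] lin_map_comp[OF pr_P S']])
    show "S (pr (t x w)) = S' (pr (t x w))" if "x \<in> carrier G" "w \<in> carrier W" for x w
      using that t lin_mapD(6)[OF S] lin_mapD(6)[OF S'] by (simp add: pr_t P_simps)
  qed (rule P_closed[OF v])
  then show ?thesis using P_fixed[OF v] by simp
qed

text \<open>The compression of \<open>\<rho> g\<close> by \<open>pr\<close> is linear on
  \<open>P\<close> and takes the prescribed values on tensors over \<open>B\<close>; by
  \<open>P_eqI\<close> no other linear map on \<open>P\<close> does.\<close>

lemma \<pi>_eq:
  assumes g: "g \<in> carrier G"
  shows "\<pi> g = (\<lambda>v\<in>carrier P. pr (\<rho> g v))"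
proof -
  have L: "lin_map P P (\<lambda>v. pr (\<rho> g v))"
    by (intro lin_map_comp[OF _ pr_P] lin_map_comp[OF incl_P] \<rho>_lin g)
  have eq: "\<pi> g = linear_extension P P (B \<times> carrier W)
      (\<lambda>(x, w). t x w) (\<lambda>(x, w). if g \<otimes> x \<in> B then t (g \<otimes> x) w else \<zero>\<^bsub>V\<^esub>)"
    by (simp add: pind_action_def Let_def t_def B_def cong: if_cong flip: K_eq)
  show ?thesis unfolding eq
  proof (rule linear_extension_eqI[OF L])
    fix S v assume S: "lin_map P P S" and v: "v \<in> carrier P"
      and *: "\<And>i. i \<in> B \<times> carrier W \<Longrightarrow>
        S (case i of (x, w) \<Rightarrow> t x w) = pr (\<rho> g (case i of (x, w) \<Rightarrow> t x w))"
    show "S v = pr (\<rho> g v)"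
      by (rule P_eqI[OF S L _ v]) (use *[of "(_, _)"] in simp)
  qed (use g B_subset in \<open>auto simp: t_P \<rho>_t pr_t subset_iff\<close>)
qed

lemma \<pi>_lin:
  assumes g: "g \<in> carrier G"
  shows "lin_map P P (\<pi> g)"
  unfolding \<pi>_eq[OF g]
  by (intro lin_map_restrict lin_map_comp[OF _ pr_P] lin_map_comp[OF incl_P] \<rho>_lin g)

lemmas \<pi>_closed = lin_mapD(3)[OF \<pi>_lin]

lemma \<pi>_zero: "g \<in> carrier G \<Longrightarrow> \<pi> g \<zero>\<^bsub>V\<^esub> = \<zero>\<^bsub>V\<^esub>"
  using lin_mapD(6)[OF \<pi>_lin] by (simp add: P_simps)

lemma \<pi>_t:
  assumes "g \<in> carrier G" "x \<in> B" "w \<in> carrier W"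
  shows "\<pi> g (t x w) = (if g \<otimes> x \<in> B then t (g \<otimes> x) w else \<zero>\<^bsub>V\<^esub>)"
  using assms B_subset by (auto simp: \<pi>_eq t_P \<rho>_t pr_t subset_iff)

lemma cancel_inv:
  assumes "g \<in> carrier G" "x \<in> B"
  shows "inv g \<otimes> (g \<otimes> x) = x" "g \<otimes> (inv g \<otimes> x) = x"
  using assms B_subset by (auto simp flip: m_assoc)

text \<open>Checked on \<open>t x w\<close> with \<open>x\<close> in \<open>B\<close>. In the first
  identity both sides are \<open>t (h \<otimes> x) w\<close> if \<open>h \<otimes> x\<close> and
  \<open>g \<otimes> h \<otimes> x\<close> lie in \<open>B\<close>, and zero otherwise. In the
  second both are \<open>t (g \<otimes> x) w\<close> if \<open>inv h \<otimes> x\<close> and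
  \<open>g \<otimes> x\<close> lie in \<open>B\<close>, and zero otherwise.\<close>

lemma partial_rep_P: "partial_rep G P \<pi>"
  unfolding partial_rep_def
proof (intro conjI ballI fd_P \<pi>_lin)
  note [simp] = \<pi>_t \<pi>_zero subsetD[OF B_subset] cancel_inv
  show "\<pi> \<one> v = v" if "v \<in> carrier P" for v
    by (rule P_eqI[OF \<pi>_lin lin_mapI[OF P_vs P_vs] _ that]) simp_all
  fix g h v assume gh: "g \<in> carrier G" "h \<in> carrier G" and v: "v \<in> carrier P"
  note comp = \<pi>_lin lin_map_comp[OF \<pi>_lin \<pi>_lin] lin_map_comp[OF lin_map_comp[OF \<pi>_lin \<pi>_lin] \<pi>_lin]
  show "\<pi> (inv g) (\<pi> (g \<otimes> h) v) = \<pi> (inv g) (\<pi> g (\<pi> h v))"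
  proof (rule P_eqI[OF comp(2) comp(3) _ v])
    fix x w assume xw: "x \<in> B" "w \<in> carrier W"
    have "g \<otimes> h \<otimes> x = g \<otimes> (h \<otimes> x)" "inv g \<otimes> (g \<otimes> (h \<otimes> x)) = h \<otimes> x"
      using xw gh by (simp_all add: m_assoc[symmetric] del: cancel_inv)
    then show "\<pi> (inv g) (\<pi> (g \<otimes> h) (t x w)) = \<pi> (inv g) (\<pi> g (\<pi> h (t x w)))"
      using xw gh by simp
  qed (use gh in simp_all)
  show "\<pi> (g \<otimes> h) (\<pi> (inv h) v) = \<pi> g (\<pi> h (\<pi> (inv h) v))"
  proof (rule P_eqI[OF comp(2) comp(3) _ v])
    fix x w assume xw: "x \<in> B" "w \<in> carrier W"
    have "g \<otimes> h \<otimes> (inv h \<otimes> x) = g \<otimes> x"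
      using xw gh by (simp add: m_assoc)
    then show "\<pi> (g \<otimes> h) (\<pi> (inv h) (t x w)) = \<pi> g (\<pi> h (\<pi> (inv h) (t x w)))"
      using xw gh by simp
  qed (use gh in simp_all)
qed

text \<open>Left multiplication by \<open>H\<close> preserves \<open>B\<close>, so nothing is cut
  off and associativity in \<open>G\<close> gives multiplicativity.\<close>

lemma global_on_H: "global_on G H P \<pi>"
  unfolding global_on_def group_rep_def
proof (intro conjI ballI fd_P; simp)
  note H_G = subgroup.mem_carrier[OF H]
  note [simp] = \<pi>_t \<pi>_zero subsetD[OF B_subset] H_B H_G
  show "lin_map P P (\<pi> h)" if "h \<in> H" for h
    using that by (simp add: \<pi>_lin)
  show "\<pi> \<one> v = v" if "v \<in> carrier P" for v
    using partial_rep_P that by (simp add: partial_rep_def)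
  show "\<pi> (g \<otimes> h) v = \<pi> g (\<pi> h v)" if gh: "g \<in> H" "h \<in> H" and v: "v \<in> carrier P" for g h v
    by (rule P_eqI[OF \<pi>_lin lin_map_comp[OF \<pi>_lin \<pi>_lin] _ v])
      (use gh subgroup.m_closed[OF H] in \<open>simp_all add: m_assoc\<close>)
qed

section \<open>The restriction and universal properties\<close>

lemma projection_eq: "pind_projection G A W \<sigma> = restrict pr (carrier V)"
proof -
  interpret V: vectorspace class_ring V by (rule V)
  have rs: "right_stable (- B)" by (rule right_stable_Compl[OF right_stable_B])
  have "(THE v. v \<in> carrier P \<and> (\<exists>z\<in>{v \<in> carrier V. proj (- B) v = v}. u = v \<oplus>\<^bsub>V\<^esub> z)) = pr u"
    if u: "u \<in> carrier V" for u
  proof (rule the_equality, intro conjI)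
    show "pr u \<in> carrier P" by (rule lin_mapD(3)[OF pr_P u])
    have "u = pr u \<oplus>\<^bsub>V\<^esub> proj (- B) u"
      using proj_split[OF right_stable_B right_stable_UNIV u] proj_all[OF right_stable_UNIV _ u] by simp
    then show "\<exists>z\<in>{v \<in> carrier V. proj (- B) v = v}. u = pr u \<oplus>\<^bsub>V\<^esub> z"
      using u by (intro bexI[of _ "proj (- B) u"]) (simp_all add: proj_proj rs lin_mapD(3)[OF proj_lin])
    fix v assume "v \<in> carrier P \<and> (\<exists>z\<in>{v \<in> carrier V. proj (- B) v = v}. u = v \<oplus>\<^bsub>V\<^esub> z)"
    then obtain z where v: "v \<in> carrier P" and z: "z \<in> carrier V" "proj (- B) z = z" "u = v \<oplus>\<^bsub>V\<^esub> z"
      by blast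
    \<comment> \<open>Uniqueness of the summand in \<open>P\<close>: as \<open>B\<close> and
      \<open>- B\<close> are disjoint, \<open>pr\<close> kills \<open>z\<close>, and applying
      \<open>pr\<close> to \<open>u\<close> leaves \<open>v\<close>.\<close>
    have "pr z = pr (proj (- B) z)" using z by simp
    also have "\<dots> = \<zero>\<^bsub>V\<^esub>"
      using z(1) by (simp add: proj_proj right_stable_B rs proj_empty)
    finally show "v = pr u"
      using v z by (simp add: P_closed P_fixed lin_mapD(4)[OF pr_lin])
  qed
  then show ?thesis
    unfolding pind_projection_def Let_def K_eq[symmetric] B_def[symmetric] complement_sum
    by (intro restrict_ext) simp
qed

text \<open>Vectors in the image of \<open>\<pi> (inv g)\<close> after \<open>\<pi> g\<close> are
  built from tensors for which both \<open>x\<close> and \<open>g \<otimes> x\<close> lie in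
  \<open>B\<close>; on these \<open>\<pi> g\<close> cuts nothing off and agrees with
  \<open>\<rho> g\<close>.\<close>

lemma restriction: "is_restriction G P \<pi> V \<rho> (pind_inclusion G A W \<sigma>) (pind_projection G A W \<sigma>)"
  unfolding is_restriction_def projection_eq pind_inclusion_def
proof (intro conjI ballI partial_rep_P)
  show "lin_map P V (\<lambda>v\<in>carrier P. v)" by (rule lin_map_restrict[OF incl_P])
  show "lin_map V P (restrict pr (carrier V))" by (rule lin_map_restrict[OF pr_P])
  show "restrict pr (carrier V) ((\<lambda>v\<in>carrier P. v) v) = v" if "v \<in> carrier P" for v
    using that by (simp add: P_closed P_fixed)
  fix g assume g: "g \<in> carrier G"
  show "\<pi> g v = restrict pr (carrier V) (\<rho> g ((\<lambda>v\<in>carrier P. v) v))" if "v \<in> carrier P" for v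
    using that g by (simp add: \<pi>_eq P_closed \<rho>_closed)
  fix v assume "v \<in> (\<lambda>v. \<pi> (inv g) (\<pi> g v)) ` carrier P"
  then obtain u where u: "u \<in> carrier P" "v = \<pi> (inv g) (\<pi> g u)" by blast
  have e: "lin_map P P (\<lambda>u. \<pi> (inv g) (\<pi> g u))"
    by (intro lin_map_comp[OF \<pi>_lin \<pi>_lin]) (use g in simp_all)
  have "\<pi> g (\<pi> (inv g) (\<pi> g u)) = \<rho> g (\<pi> (inv g) (\<pi> g u))"
  proof (rule P_eqI[OF lin_map_comp[OF lin_map_comp[OF e \<pi>_lin] incl_P]
        lin_map_comp[OF lin_map_comp[OF e incl_P] \<rho>_lin] _ u(1)])
    fix x w assume xw: "x \<in> B" "w \<in> carrier W"
    then show "\<pi> g (\<pi> (inv g) (\<pi> g (t x w))) = \<rho> g (\<pi> (inv g) (\<pi> g (t x w)))"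
      using g lin_mapD(6)[OF \<rho>_lin[OF g]]
      by (simp add: \<pi>_t \<pi>_zero cancel_inv \<rho>_t subsetD[OF B_subset])
  qed (use g in simp_all)
  moreover have "\<pi> (inv g) (\<pi> g u) \<in> carrier P" "\<pi> g (\<pi> (inv g) (\<pi> g u)) \<in> carrier P"
    using u g by (simp_all add: \<pi>_closed)
  ultimately show "(\<lambda>v\<in>carrier P. v) (\<pi> g v) = \<rho> g ((\<lambda>v\<in>carrier P. v) v)"
    unfolding u(2) by (simp only: restrict_apply' if_True)
qed

lemma universal:
  fixes U' :: "(complex, 'u) module"
  assumes U': "group_rep G U' \<rho>'" and r: "is_restriction G P \<pi> U' \<rho>' \<phi>' \<tau>'"
  shows "\<exists>!\<psi>. \<psi> \<in> extensional (carrier V) \<and> rep_hom G V \<rho> U' \<rho>' \<psi> \<and>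
    (\<forall>v\<in>carrier P. \<psi> (pind_inclusion G A W \<sigma> v) = \<phi>' v) \<and>
    (\<forall>u\<in>carrier V. \<tau>' (\<psi> u) = pind_projection G A W \<sigma> u)"
proof -
  have \<rho>'_lin: "lin_map U' U' (\<rho>' g)" if "g \<in> carrier G" for g
    using U' that by (simp add: group_rep_def)
  have \<rho>'_mult: "\<rho>' (g \<otimes> h) v = \<rho>' g (\<rho>' h v)"
    if "g \<in> carrier G" "h \<in> carrier G" "v \<in> carrier U'" for g h v
    using U' that by (simp add: group_rep_def)
  have \<phi>': "lin_map P U' \<phi>'" and \<tau>': "lin_map U' P \<tau>'"
    and \<pi>': "\<And>g v. g \<in> carrier G \<Longrightarrow> v \<in> carrier P \<Longrightarrow> \<pi> g v = \<tau>' (\<rho>' g (\<phi>' v))"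
    using r by (simp_all add: is_restriction_def)
  note \<phi>'_closed = lin_mapD(3)[OF \<phi>']
  have t1: "t \<one> w \<in> carrier P" if "w \<in> carrier W" for w using that t_P one_B by simp
  \<comment> \<open>Since \<open>\<one>\<close> and \<open>x\<close> lie in \<open>B\<close>, the
    operator \<open>\<pi> x\<close> takes \<open>t \<one> w\<close> to \<open>t x w\<close> and
    \<open>\<pi> (inv x)\<close> takes it back. So \<open>t \<one> w\<close> belongs to the vectors
    on which \<open>\<phi>'\<close> intertwines \<open>\<pi> x\<close> with
    \<open>\<rho>' x\<close>.\<close>
  have \<phi>'_t: "\<phi>' (t x w) = \<rho>' x (\<phi>' (t \<one> w))" if xw: "x \<in> B" "w \<in> carrier W" for x w
  proof -
    have x: "x \<in> carrier G" using xw B_subset by auto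
    have "t \<one> w = \<pi> (inv x) (\<pi> x (t \<one> w))" using xw x by (simp add: \<pi>_t one_B)
    then have "t \<one> w \<in> (\<lambda>v. \<pi> (inv x) (\<pi> x v)) ` carrier P" using t1[OF xw(2)] by blast
    then have "\<phi>' (\<pi> x (t \<one> w)) = \<rho>' x (\<phi>' (t \<one> w))"
      using r x unfolding is_restriction_def by blast
    then show ?thesis using xw x by (simp add: \<pi>_t one_B)
  qed
  \<comment> \<open>As \<open>K\<close> is contained in \<open>B\<close>, \<open>\<phi>'_t\<close>
    applies to \<open>k\<close>: \<open>\<rho>' k (\<phi>' (t \<one> w))\<close> is
    \<open>\<phi>' (t k w)\<close>, and \<open>t k w = t \<one> (\<sigma> k w)\<close>.\<close>
  have translate: "\<rho>' (x \<otimes> k) (\<phi>' (t \<one> w)) = \<rho>' x (\<phi>' (t \<one> (\<sigma> k w)))"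
    if "x \<in> carrier G" "k \<in> K" "w \<in> carrier W" for x k w
    using that K_subset[of k] t_translate[of \<one> k w]
    by (simp add: \<rho>'_mult \<phi>'_closed t1 K_B flip: \<phi>'_t)
  obtain L where L: "lin_map V U' L"
    "\<And>x w. x \<in> carrier G \<Longrightarrow> w \<in> carrier W \<Longrightarrow> L (t x w) = \<rho>' x (\<phi>' (t \<one> w))"
    by (rule ind_universal[of U' "\<lambda>x w. \<rho>' x (\<phi>' (t \<one> w))"])
      (auto simp: translate intro!: lin_map_comp[OF _ \<rho>'_lin] lin_map_comp[OF lin_map_t_P[OF one_B] \<phi>'])
  show ?thesis
  proof (rule ex1I[of _ "restrict L (carrier V)"], intro conjI ballI)
    show "rep_hom G V \<rho> U' \<rho>' (restrict L (carrier V))"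
      unfolding rep_hom_def
    proof (intro conjI ballI lin_map_restrict[OF L(1)])
      fix g u assume g: "g \<in> carrier G" and u: "u \<in> carrier V"
      have "L (\<rho> g u) = \<rho>' g (L u)"
        by (rule lin_map_eqI[OF lin_map_comp[OF \<rho>_lin L(1)] lin_map_comp[OF L(1) \<rho>'_lin] _ u])
          (simp_all add: g \<rho>_t L(2) \<rho>'_mult \<phi>'_closed t1)
      then show "restrict L (carrier V) (\<rho> g u) = \<rho>' g (restrict L (carrier V) u)"
        using g u by (simp add: \<rho>_closed)
    qed
    show "restrict L (carrier V) (pind_inclusion G A W \<sigma> v) = \<phi>' v" if v: "v \<in> carrier P" for v
    proof -
      have "L v = \<phi>' v"
        by (rule P_eqI[OF lin_map_comp[OF incl_P L(1)] \<phi>' _ v])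
          (simp add: L(2) \<phi>'_t subsetD[OF B_subset])
      then show ?thesis using v by (simp add: pind_inclusion_def P_closed)
    qed
    \<comment> \<open>On \<open>t x w\<close> the left side is \<open>\<tau>' (\<rho>' x (\<phi>' (t
      \<one> w))) = \<pi> x (t \<one> w)\<close>, which is \<open>t x w\<close> for \<open>x\<close>
      in \<open>B\<close> and zero otherwise, exactly as for \<open>pr\<close>.\<close>
    show "\<tau>' (restrict L (carrier V) u) = pind_projection G A W \<sigma> u" if u: "u \<in> carrier V" for u
    proof -
      have "\<tau>' (L u) = pr u"
        by (rule lin_map_eqI[OF lin_map_comp[OF L(1) \<tau>'] pr_P _ u])
          (simp add: L(2) pr_t t1 \<pi>_t one_B flip: \<pi>')
      then show ?thesis using u by (simp add: projection_eq)
    qed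
  next
    fix \<psi> assume \<psi>: "\<psi> \<in> extensional (carrier V) \<and> rep_hom G V \<rho> U' \<rho>' \<psi> \<and>
      (\<forall>v\<in>carrier P. \<psi> (pind_inclusion G A W \<sigma> v) = \<phi>' v) \<and>
      (\<forall>u\<in>carrier V. \<tau>' (\<psi> u) = pind_projection G A W \<sigma> u)"
    then have \<psi>_lin: "lin_map V U' \<psi>"
      and \<psi>_\<rho>: "\<And>g u. g \<in> carrier G \<Longrightarrow> u \<in> carrier V \<Longrightarrow> \<psi> (\<rho> g u) = \<rho>' g (\<psi> u)"
      by (simp_all add: rep_hom_def)
    have \<psi>_\<phi>: "\<psi> v = \<phi>' v" if "v \<in> carrier P" for v
      using \<psi> that by (simp add: pind_inclusion_def)
    \<comment> \<open>Every generator is \<open>\<rho> x (t \<one> w)\<close> with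
      \<open>t \<one> w\<close> in \<open>P\<close>, so equivariance and \<open>\<phi>'\<close>
      determine \<open>\<psi>\<close>.\<close>
    have "\<psi> u = L u" if u: "u \<in> carrier V" for u
    proof (rule lin_map_eqI[OF \<psi>_lin L(1) _ u])
      fix x w assume xw: "x \<in> carrier G" "w \<in> carrier W"
      have "\<psi> (t x w) = \<psi> (\<rho> x (t \<one> w))" using xw by (simp add: \<rho>_t)
      then show "\<psi> (t x w) = L (t x w)" using xw by (simp add: \<psi>_\<rho> \<psi>_\<phi> t1 t_closed L(2))
    qed
    then show "\<psi> = restrict L (carrier V)"
      using \<psi> by (intro extensionalityI[of _ "carrier V"]) auto
  qed simp
qed

lemma globalization:
  "is_globalization TYPE('u) G P \<pi> V \<rho> (pind_inclusion G A W \<sigma>) (pind_projection G A W \<sigma>)"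
  unfolding is_globalization_def
  by (intro conjI allI impI group_rep_ind restriction, elim conjE, rule universal)

section \<open>Irreducibility\<close>

lemma \<pi>_inv_\<pi>:
  assumes g: "g \<in> carrier G" and v: "v \<in> carrier P"
  shows "\<pi> (inv g) (\<pi> g v) = proj {x. g \<otimes> x \<in> B} v"
  \<comment> \<open>The operator \<open>\<pi> g\<close> kills \<open>t x w\<close> unless
    \<open>g \<otimes> x\<close> lies in \<open>B\<close>; otherwise \<open>\<pi> (inv g)\<close>
    undoes the translation.\<close>
  by (rule P_eqI[OF lin_map_comp[OF lin_map_comp[OF \<pi>_lin \<pi>_lin] incl_P] lin_map_comp[OF incl_P proj_lin] _ v])
    (use g in \<open>simp_all add: \<pi>_t \<pi>_zero cancel_inv proj_t right_stable_vimage right_stable_B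
      subsetD[OF B_subset]\<close>)

text \<open>Composing the idempotents \<open>\<pi>(g\<^sup>-\<^sup>1)\<pi>(g)\<close> over all \<open>g\<close> with \<open>gx \<in> B\<close> isolates the
  component of the coset \<open>xK\<close>.\<close>

lemma coset_component_in_invariant:
  assumes N: "subspace class_ring N P" "\<And>g. g \<in> carrier G \<Longrightarrow> \<pi> g ` N \<subseteq> N"
    and x: "x \<in> B" and v: "v \<in> N"
  shows "proj (x <# K) v \<in> N"
proof -
  define S where "S g = {y. g \<otimes> y \<in> B}" for g
  have S: "right_stable (S g)" if "g \<in> carrier G" for g
    using that by (simp add: S_def right_stable_vimage right_stable_B)
  have N_P: "u \<in> carrier P" if "u \<in> N" for u using subspaceD(2)[OF N(1)] that by auto
  have xG: "x \<in> carrier G" using x B_subset by auto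
  \<comment> \<open>These are the \<open>g\<close> in \<open>G\<close> with
    \<open>g \<otimes> x\<close> in \<open>B\<close>. An element \<open>y\<close> of
    \<open>G\<close> lies in all \<open>S g\<close> iff \<open>b \<otimes> inv x \<otimes> y\<close>
    stays in \<open>B\<close> for every \<open>b\<close> in \<open>B\<close>, which means that
    \<open>inv x \<otimes> y\<close> is in \<open>K\<close>.\<close>
  define I where "I = (\<lambda>b. b \<otimes> inv x) ` B"
  have I: "finite I" "I \<subseteq> carrier G"
    using B_subset xG finite_subset[OF B_subset finite_G] by (auto simp: I_def)
  then have "right_stable (\<Inter>g\<in>I. S g) \<and> proj (\<Inter>g\<in>I. S g) v \<in> N"
  proof (induction I rule: finite_induct)
    case empty
    then show ?case using v proj_all[OF right_stable_UNIV _ P_closed[OF N_P[OF v]]]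
      by (simp add: right_stable_UNIV)
  next
    case (insert g I)
    define Z where "Z = (\<Inter>g\<in>I. S g)"
    have g: "g \<in> carrier G" and IH: "right_stable Z" "proj Z v \<in> N" using insert by (auto simp: Z_def)
    have "proj (S g \<inter> Z) v = proj (S g) (proj Z v)"
      using IH S g v N_P P_closed by (simp add: proj_proj)
    also have "\<dots> = \<pi> (inv g) (\<pi> g (proj Z v))"
      using \<pi>_inv_\<pi>[OF g N_P[OF IH(2)]] by (simp add: S_def)
    also have "\<dots> \<in> N" using N(2)[OF g] N(2)[OF inv_closed[OF g]] IH(2) by blast
    finally show ?case using S[OF g] IH(1) by (simp add: Z_def right_stable_Int)
  qed
  moreover have "y \<in> (\<Inter>g\<in>I. S g) \<longleftrightarrow> y \<in> x <# K" if y: "y \<in> carrier G" for y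
  proof
    assume "y \<in> (\<Inter>g\<in>I. S g)"
    then have "inv x \<otimes> y \<in> K"
      by (intro stabilizer_of_translates xG y) (auto simp: S_def I_def)
    then show "y \<in> x <# K" using subgroup.lcos_module_rev[OF K is_group xG y] by simp
  next
    assume "y \<in> x <# K"
    then obtain k where k: "k \<in> K" "y = x \<otimes> k" by (auto simp: l_coset_def)
    have "b \<otimes> inv x \<otimes> y \<in> B" if b: "b \<in> B" for b
    proof -
      have "b \<otimes> inv x \<otimes> y = b \<otimes> k"
        using b k xG K_subset B_subset by (simp add: m_assoc subset_iff flip: m_assoc[of "inv x" x])
      then show ?thesis using right_stable_B b k B_subset by (auto simp: right_stable_def)
    qed
    then show "y \<in> (\<Inter>g\<in>I. S g)" by (auto simp: S_def I_def)
  qed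
  ultimately show ?thesis
    using proj_eqI[OF _ right_stable_coset[OF xG] P_closed[OF N_P[OF v]]] by metis
qed

text \<open>Cosets are split off one at a time with \<open>proj_split\<close>. Distinct elements of
  \<open>I\<close> may define the same coset, so the union need not be disjoint as indexed.\<close>

lemma zero_if_components_zero:
  assumes v: "v \<in> carrier V" and "finite I" "I \<subseteq> carrier G"
    and "\<And>x. x \<in> I \<Longrightarrow> proj (x <# K) v = \<zero>\<^bsub>V\<^esub>"
  shows "proj (\<Union>x\<in>I. x <# K) v = \<zero>\<^bsub>V\<^esub>"
  using assms(2-)
proof (induction I rule: finite_induct)
  case empty
  then show ?case using v by (simp add: proj_empty)
next
  case (insert x I)
  have "right_stable (\<Union>x\<in>I. x <# K)"
    using insert.prems by (intro right_stable_Union) (auto intro: right_stable_coset)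
  then show ?case
    using insert v right_stable_coset[of x]
    by (simp add: proj_split VD lin_mapD(6)[OF proj_lin] right_stable_Compl)
qed

lemma irreducible:
  assumes irr: "irreducible_rep (G\<lparr>carrier := K\<rparr>) W \<sigma>"
  shows "irreducible_rep G P \<pi>"
  unfolding irreducible_rep_def P_simps
proof (intro conjI allI impI)
  obtain w where w: "w \<in> carrier W" "w \<noteq> \<zero>\<^bsub>W\<^esub>"
    using irr WD(1) by (auto simp: irreducible_rep_def)
  show "carrier P \<noteq> {\<zero>\<^bsub>V\<^esub>}"
    using t_one_nonzero[OF w] t_P[OF one_B w(1)] by auto
  fix N assume "subspace class_ring N P \<and> (\<forall>g\<in>carrier G. \<pi> g ` N \<subseteq> N)"
  then have N: "subspace class_ring N P" "\<And>g. g \<in> carrier G \<Longrightarrow> \<pi> g ` N \<subseteq> N" by auto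
  note ND = subspaceD[OF N(1), unfolded P_simps]
  show "N = {\<zero>\<^bsub>V\<^esub>} \<or> N = carrier P"
  proof (cases "\<exists>x w. x \<in> B \<and> w \<in> carrier W \<and> t x w \<in> N \<and> t x w \<noteq> \<zero>\<^bsub>V\<^esub>")
    \<comment> \<open>Each coset component of \<open>v\<close> lies in \<open>N\<close> and is a
      single tensor, so it vanishes by the case assumption. These cosets cover \<open>B\<close>,
      hence \<open>v = pr v\<close> is zero.\<close>
    case False
    have "v = \<zero>\<^bsub>V\<^esub>" if v: "v \<in> N" for v
    proof -
      have vP: "v \<in> carrier P" using v ND(2) by auto
      have "proj (x <# K) v = \<zero>\<^bsub>V\<^esub>" if x: "x \<in> B" for x
      proof -
        obtain w where "w \<in> carrier W" "proj (x <# K) v = t x w"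
          using proj_coset[of x v] x B_subset P_closed[OF vP] by blast
        then show ?thesis using coset_component_in_invariant[OF N x v] False x by metis
      qed
      then have "proj (\<Union>x\<in>B. x <# K) v = \<zero>\<^bsub>V\<^esub>"
        using P_closed[OF vP] B_subset finite_subset[OF B_subset finite_G]
        by (intro zero_if_components_zero)
      moreover have "(\<Union>x\<in>B. x <# K) = B"
        using right_stable_B B_subset lcos_self[OF _ K]
        by (auto simp: right_stable_def l_coset_def subset_iff)
      ultimately show ?thesis using P_fixed[OF vP] by simp
    qed
    then have "N = {\<zero>\<^bsub>V\<^esub>}" using ND(3) by blast
    then show ?thesis ..
  next
    case True
    then obtain x w where x: "x \<in> B" and w: "w \<in> carrier W" and txw: "t x w \<in> N" "t x w \<noteq> \<zero>\<^bsub>V\<^esub>"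
      by blast
    have xG: "x \<in> carrier G" using x B_subset by auto
    \<comment> \<open>The trace of \<open>N\<close> on the copy of \<open>W\<close> over
      \<open>\<one>\<close>. It is \<open>K\<close>-invariant since \<open>K\<close> is contained in
      \<open>B\<close>, and it contains \<open>w\<close> because \<open>\<pi> (inv x)\<close> moves
      \<open>t x w\<close> to \<open>t \<one> w\<close>; irreducibility of \<open>W\<close> then
      makes it all of \<open>W\<close>.\<close>
    define N' where "N' = {w \<in> carrier W. t \<one> w \<in> N}"
    have "subspace class_ring N' W"
      unfolding N'_def by (rule subspace_vimage[OF lin_map_t_P[OF one_B] N(1)])
    moreover have "\<sigma> k ` N' \<subseteq> N'" if k: "k \<in> K" for k
    proof safe
      fix u assume u: "u \<in> N'"
      have "t \<one> (\<sigma> k u) = \<pi> k (t \<one> u)"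
        using u k K_subset[OF k] t_translate[of \<one> k u] by (simp add: N'_def \<pi>_t one_B K_B)
      then show "\<sigma> k u \<in> N'"
        using u k N(2)[OF K_subset[OF k]] by (auto simp: N'_def \<sigma>_closed)
    qed
    ultimately have "N' = {\<zero>\<^bsub>W\<^esub>} \<or> N' = carrier W"
      using irr by (simp add: irreducible_rep_def)
    moreover have "w \<in> N'"
    proof -
      have "\<pi> (inv x) (t x w) = t \<one> w" using xG x w by (simp add: \<pi>_t one_B)
      then show ?thesis using N(2)[OF inv_closed[OF xG]] txw(1) w by (force simp: N'_def)
    qed
    moreover have "w \<noteq> \<zero>\<^bsub>W\<^esub>" using txw(2) t_zero[OF xG] by auto
    ultimately have N': "t \<one> u \<in> N" if "u \<in> carrier W" for u using that by (auto simp: N'_def)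
    have t_N: "t y u \<in> N" if "y \<in> B" "u \<in> carrier W" for y u
    proof -
      have y: "y \<in> carrier G" using that B_subset by auto
      have "\<pi> y (t \<one> u) = t y u" using that y by (simp add: \<pi>_t one_B)
      then show ?thesis using N(2)[OF y] N'[OF that(2)] by force
    qed
    \<comment> \<open>Vectors of \<open>P\<close> are fixed by \<open>pr\<close>, and
      \<open>pr\<close> turns each generator of \<open>V\<close> into a tensor over \<open>B\<close>
      or into zero, both of which lie in \<open>N\<close>.\<close>
    have "pr v \<in> N" if "v \<in> carrier V" for v
      using that
      by (induction rule: ind_induct) (auto simp: pr_t t_N ND(3,4) lin_mapD(4)[OF pr_lin])
    then have "carrier P \<subseteq> N" using P_closed P_fixed by (metis subsetI)
    then show ?thesis using ND(2) by auto
  qed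
qed

end

theorem theorem4p4:
  fixes G :: "('g, 'm) monoid_scheme" and H A K :: "'g set"
    and W :: "(complex, 'w) module" and \<sigma> :: "'g \<Rightarrow> 'w \<Rightarrow> 'w"
  assumes "group G" and "finite (carrier G)" and "subgroup H G"
    and "A \<in> coset_unions G H"
    and "K = left_stabilizer G A"
    and "group_rep (G\<lparr>carrier := K\<rparr>) W \<sigma>"
    and "irreducible_rep (G\<lparr>carrier := K\<rparr>) W \<sigma>"
  shows "partial_rep G (pind_space G A W \<sigma>) (pind_action G A W \<sigma>) \<and>
    global_on G H (pind_space G A W \<sigma>) (pind_action G A W \<sigma>) \<and>
    irreducible_rep G (pind_space G A W \<sigma>) (pind_action G A W \<sigma>) \<and>
    is_globalization TYPE('u) G
      (pind_space G A W \<sigma>) (pind_action G A W \<sigma>)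
      (ind_space G K W \<sigma>) (ind_action G K W \<sigma>)
      (pind_inclusion G A W \<sigma>) (pind_projection G A W \<sigma>)"
proof -
  interpret group G by fact
  have "subgroup K G"
    unfolding assms(5) by (rule subgroup_left_stabilizer[OF coset_unions_subset[OF assms(3,4)]])
  then interpret coset_union_data G K W \<sigma> H A
    using assms
    by (intro coset_union_data.intro induction_data.intro induction_data_axioms.intro
      coset_union_data_axioms.intro)
  show ?thesis
    by (intro conjI partial_rep_P global_on_H irreducible[OF assms(7)] globalization)
qed

end
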